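(* Let $K>0$ be a constant, and let $E\subset\mathbb T$ be a Borel subset of the unit circle such that $\mu(E)\le K\limsup_{n\to\infty}|\hat\mu(n)|$ for every positive finite Borel measure $\mu$ on $\mathbb T$ with $\mu(E)=\mu(\mathbb T)$. Let $U$ be a unitary operator, let $\nu$ be the scalar spectral measure of $U$, and let $\nu(E)=\nu(\mathbb T)$. Suppose that $T$ is a power bounded operator such that $T\sim U$. Then $T\approx U$ and $$\sup_{n\le 0}\|T^n\|\le K^3\Bigl(\sup_{n\ge 0}\|T^n\|\Bigr)^8.$$
   Context: All Hilbert spaces are complex and separable; operators are linear and bounded. $T$ is power bounded if $\sup_{n\ge 0}\|T^n\|<\infty$. For operators $T$ on $\mathcal H$ and $R$ on $\mathcal K$: $T\approx R$ (similar) means there is a bounded invertible $X:\mathcal H\to\mathcal K$ with bounded inverse and $XT=RX$; $T\prec R$ means there is a bounded linear $X:\mathcal H\to\mathcal K$ with $\ker X=\{0\}$, dense range, and $XT=RX$; $T\sim R$ (quasisimilar) means $T\prec R$ and $R\prec T$. A bound on $\sup_{n\le 0}\|T^n\|$ includes the assertion that $T$ is invertible with bounded inverse. $\hat\mu(n)=\int_{\mathbb T}\zeta^{-n}\,d\mu(\zeta)$, $n\in\mathbb Z$. The scalar spectral measure of a unitary operator $U$ is a finite positive Borel measure on $\mathbb T$ that is mutually absolutely continuous with the (projection-valued) spectral measure of $U$. *)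

theory Defs
  imports "HOL-Analysis.Analysis"
begin

text \<open>
  Complex Hilbert spaces.  The norm, the topology and completeness come from the library classes;
  the real inner product of the underlying real Hilbert space is the real part of the complex one,
  so that \<open>norm x = sqrt (Re (cinner x x))\<close>.  The complex inner product is linear in the first
  argument.
\<close>

class complex_hilbert_space = real_inner + complete_space +
  fixes scaleC :: "complex \<Rightarrow> 'a \<Rightarrow> 'a"  (infixr "*\<^sub>C" 75)
    and cinner :: "'a \<Rightarrow> 'a \<Rightarrow> complex"
  assumes scaleC_add_right: "c *\<^sub>C (x + y) = c *\<^sub>C x + c *\<^sub>C y"
    and scaleC_add_left: "(c + d) *\<^sub>C x = c *\<^sub>C x + d *\<^sub>C x"
    and scaleC_scaleC: "c *\<^sub>C (d *\<^sub>C x) = (c * d) *\<^sub>C x"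
    and scaleC_one: "1 *\<^sub>C x = x"
    and scaleR_scaleC: "r *\<^sub>R x = complex_of_real r *\<^sub>C x"
    and cinner_commute: "cinner x y = cnj (cinner y x)"
    and cinner_add_left: "cinner (x + y) z = cinner x z + cinner y z"
    and cinner_scaleC_left: "cinner (c *\<^sub>C x) y = c * cinner x y"
    and inner_eq_Re_cinner: "inner x y = Re (cinner x y)"

instantiation complex :: complex_hilbert_space
begin

definition scaleC_complex :: "complex \<Rightarrow> complex \<Rightarrow> complex"
  where "scaleC_complex c z = c * z"

definition cinner_complex :: "complex \<Rightarrow> complex \<Rightarrow> complex"
  where "cinner_complex z w = z * cnj w"

instance
  by standard
    (simp_all add: scaleC_complex_def cinner_complex_def algebra_simps scaleR_conv_of_real
      inner_complex_def)

end

definition bounded_clinear ::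
    "('a::complex_hilbert_space \<Rightarrow> 'b::complex_hilbert_space) \<Rightarrow> bool" where
  "bounded_clinear X \<longleftrightarrow> bounded_linear X \<and> (\<forall>c x. X (c *\<^sub>C x) = c *\<^sub>C X x)"

definition is_adjoint ::
    "('a::complex_hilbert_space \<Rightarrow> 'b::complex_hilbert_space) \<Rightarrow> ('b \<Rightarrow> 'a) \<Rightarrow> bool" where
  "is_adjoint X Y \<longleftrightarrow> (\<forall>x y. cinner (X x) y = cinner x (Y y))"

definition unitary_op :: "('a::complex_hilbert_space \<Rightarrow> 'a) \<Rightarrow> bool" where
  "unitary_op U \<longleftrightarrow> bounded_clinear U \<and>
    (\<exists>V. bounded_clinear V \<and> is_adjoint U V \<and> V \<circ> U = id \<and> U \<circ> V = id)"

definition orthogonal_projection :: "('a::complex_hilbert_space \<Rightarrow> 'a) \<Rightarrow> bool" where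
  "orthogonal_projection P \<longleftrightarrow> bounded_clinear P \<and> P \<circ> P = P \<and> is_adjoint P P"

definition power_bounded :: "('a::complex_hilbert_space \<Rightarrow> 'a) \<Rightarrow> bool" where
  "power_bounded T \<longleftrightarrow> bdd_above (range (\<lambda>n::nat. onorm (T ^^ n)))"

definition invertible_op ::
    "('a::complex_hilbert_space \<Rightarrow> 'b::complex_hilbert_space) \<Rightarrow> bool" where
  "invertible_op X \<longleftrightarrow> bounded_clinear X \<and> bij X \<and> bounded_clinear (inv X)"

definition op_similar ::
    "('a::complex_hilbert_space \<Rightarrow> 'a) \<Rightarrow> ('b::complex_hilbert_space \<Rightarrow> 'b) \<Rightarrow> bool"
    (infix "\<approx>\<^sub>o" 50) where
  "T \<approx>\<^sub>o R \<longleftrightarrow> (\<exists>X :: 'a \<Rightarrow> 'b. invertible_op X \<and> X \<circ> T = R \<circ> X)"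

definition quasiaffine_transform ::
    "('a::complex_hilbert_space \<Rightarrow> 'a) \<Rightarrow> ('b::complex_hilbert_space \<Rightarrow> 'b) \<Rightarrow> bool"
    (infix "\<prec>\<^sub>o" 50) where
  "T \<prec>\<^sub>o R \<longleftrightarrow>
    (\<exists>X :: 'a \<Rightarrow> 'b. bounded_clinear X \<and> {x. X x = 0} = {0} \<and> closure (range X) = UNIV \<and>
      X \<circ> T = R \<circ> X)"

definition quasisimilar ::
    "('a::complex_hilbert_space \<Rightarrow> 'a) \<Rightarrow> ('b::complex_hilbert_space \<Rightarrow> 'b) \<Rightarrow> bool"
    (infix "\<sim>\<^sub>o" 50) where
  "T \<sim>\<^sub>o R \<longleftrightarrow> T \<prec>\<^sub>o R \<and> R \<prec>\<^sub>o T"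

text \<open>Integer powers; for \<open>n < 0\<close> these are meaningful only if \<open>T\<close> is bijective.\<close>

definition op_powi :: "('a \<Rightarrow> 'a) \<Rightarrow> int \<Rightarrow> 'a \<Rightarrow> 'a" where
  "op_powi T n = (if n \<ge> 0 then T ^^ nat n else inv T ^^ nat (- n))"

abbreviation unit_circle :: "complex set" where
  "unit_circle \<equiv> sphere 0 1"

definition circle_borel :: "complex measure" where
  "circle_borel = restrict_space borel unit_circle"

text \<open>Measures in the library are positive, with values in \<open>ennreal\<close>.\<close>

definition finite_circle_measure :: "complex measure \<Rightarrow> bool" where
  "finite_circle_measure \<mu> \<longleftrightarrow> sets \<mu> = sets circle_borel \<and> finite_measure \<mu>"

definition fourier_coeff :: "complex measure \<Rightarrow> int \<Rightarrow> complex" where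
  "fourier_coeff \<mu> n = (LINT \<zeta>|\<mu>. \<zeta> powi (- n))"

text \<open>Countable additivity is in the strong operator topology.\<close>

definition projection_valued_measure ::
    "(complex set \<Rightarrow> 'a::complex_hilbert_space \<Rightarrow> 'a) \<Rightarrow> bool" where
  "projection_valued_measure P \<longleftrightarrow>
    (\<forall>A \<in> sets circle_borel. orthogonal_projection (P A)) \<and>
    P {} = (\<lambda>x. 0) \<and> P unit_circle = id \<and>
    (\<forall>A \<in> sets circle_borel. \<forall>B \<in> sets circle_borel. P (A \<inter> B) = P A \<circ> P B) \<and>
    (\<forall>A :: nat \<Rightarrow> complex set. range A \<subseteq> sets circle_borel \<longrightarrow> disjoint_family A \<longrightarrow>
      (\<forall>x. (\<lambda>i. P (A i) x) sums P (\<Union>i. A i) x))"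

text \<open>
  The positive measure that sends \<open>A\<close> to \<open>cinner (P A x) x\<close>, a number that is real and nonnegative
  because \<open>P A\<close> is an orthogonal projection.
\<close>

definition pvm_diag ::
    "(complex set \<Rightarrow> 'a::complex_hilbert_space \<Rightarrow> 'a) \<Rightarrow> 'a \<Rightarrow> complex measure" where
  "pvm_diag P x =
    measure_of unit_circle (sets circle_borel) (\<lambda>A. ennreal (Re (cinner (P A x) x)))"

text \<open>
  \<open>P\<close> is the spectral measure of \<open>U\<close>, that is, \<open>U\<close> is the integral of \<open>\<zeta>\<close> with respect to \<open>P\<close>.
  The operator integral is taken in the weak sense; by polarization the quadratic form determines it.
\<close>

definition is_spectral_measure ::
    "('a::complex_hilbert_space \<Rightarrow> 'a) \<Rightarrow> (complex set \<Rightarrow> 'a \<Rightarrow> 'a) \<Rightarrow> bool" where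
  "is_spectral_measure U P \<longleftrightarrow> projection_valued_measure P \<and>
    (\<forall>x. cinner (U x) x = (LINT \<zeta>|pvm_diag P x. \<zeta>))"

text \<open>
  By the spectral theorem a unitary operator has exactly one spectral measure, up to the values on
  sets that are not Borel.
\<close>

definition scalar_spectral_measure ::
    "('a::complex_hilbert_space \<Rightarrow> 'a) \<Rightarrow> complex measure \<Rightarrow> bool" where
  "scalar_spectral_measure U \<nu> \<longleftrightarrow> finite_circle_measure \<nu> \<and>
    (\<exists>P. is_spectral_measure U P \<and>
      (\<forall>A \<in> sets circle_borel. emeasure \<nu> A = 0 \<longleftrightarrow> P A = (\<lambda>x. 0)))"

end

theory Submission
  imports Defs
begin

text \<open>
  Write \<open>M\<close> for the supremum of \<open>onorm (T ^^ n)\<close>.  The proof finds one operator \<open>J\<close> with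
  \<open>J T = U J\<close> and \<open>norm (J x) \<le> M * norm x\<close>, and shows \<open>norm x \<le> K * M * norm (J x)\<close>.  As
  its range is dense, \<open>J\<close> is a similarity, and since \<open>norm (J x) = norm (U\<^sup>m (J x)) = norm (J (T\<^sup>m x))\<close>, the two
  inequalities give \<open>norm x \<le> K * M\<^sup>2 * norm (T\<^sup>m x)\<close>.  This bounds the negative powers of \<open>T\<close>
  by \<open>K * M\<^sup>2\<close>, which is at most \<open>K\<^sup>3 * M\<^sup>8\<close>: on a nonzero space both \<open>K\<close> and \<open>M\<close> are at
  least 1, and on the zero space \<open>M = 0\<close>.

  The operator \<open>J\<close> is the isometric asymptote of \<open>T\<close>, realised on the space of \<open>U\<close>.  Let
  \<open>Y U = T Y\<close> with \<open>Y\<close> injective of dense range, and let \<open>L\<close> be a Banach limit.  The form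
  \<open>b k l = L (inner (T\<^sup>n (Y k)) (T\<^sup>n (Y l)))\<close> is positive and invariant under \<open>U\<close>, so
  \<open>b k l = inner (S k) (S l)\<close> for a self-adjoint \<open>S\<close> that commutes with \<open>U\<close>.  The estimate
  \<open>norm (S k) \<le> M * norm (Y k)\<close> shows that \<open>S = J Y\<close> for a bounded \<open>J\<close>, and by construction the
  orbit of every \<open>x\<close> contains vectors of norm below \<open>norm (J x) + e\<close>; hence
  \<open>norm (T\<^sup>n x)\<close> is eventually at most \<open>M * (norm (J x) + e)\<close> for each \<open>e > 0\<close>
  (\<open>isometric_asymptote\<close>).

  The hypothesis on \<open>E\<close> enters through the spectral measure \<open>P\<close> of \<open>U\<close>.  The measure
  \<open>cinner (P A k) k\<close> is concentrated on \<open>E\<close>, has total mass \<open>(norm k)\<^sup>2\<close>, and the moduli of its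
  Fourier coefficients are those of \<open>cinner (U\<^sup>n k) k\<close>, so that
  \<open>(norm k)\<^sup>2 \<le> K * limsup (cmod (cinner (U\<^sup>n k) k))\<close> (\<open>recurrence_of_unitary\<close>).  For
  \<open>k = J x\<close> and the adjoint \<open>G\<close> of \<open>J\<close>, the number \<open>cinner (U\<^sup>n (J x)) (J x)\<close> equals
  \<open>cinner (T\<^sup>n x) (G (J x))\<close>.  Therefore \<open>(norm (J x))\<^sup>2 \<le> K * M * norm (J x) * norm (G (J x))\<close>, and
  \<open>norm u \<le> K * M * norm (G u)\<close> first for \<open>u\<close> in the range of \<open>J\<close> and, as this range is dense,
  for all \<open>u\<close>.  Since \<open>J\<close> is injective, \<open>G\<close> has dense range, so \<open>G\<close> is onto, and the same lower
  bound holds for \<open>J\<close> (\<open>invertible_asymptote\<close>).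
\<close>

section \<open>Orthogonality and extension in real Hilbert spaces\<close>

text \<open>
  The vector \<open>v\<close> minimises \<open>inner w w - 2 * f w\<close> over \<open>V\<close>; the parallelogram law makes every
  minimising sequence a Cauchy sequence.  The case \<open>V = UNIV\<close> is the Riesz representation
  theorem, and the case \<open>f = inner y\<close> is the orthogonal projection of \<open>y\<close> to \<open>V\<close>.
\<close>

lemma riesz_on_closed_subspace:
  fixes f :: "'a::{real_inner,complete_space} \<Rightarrow> real"
  assumes f: "bounded_linear f" and V: "subspace V" "closed V"
  shows "\<exists>v\<in>V. \<forall>w\<in>V. inner v w = f w"
proof -
  interpret f: bounded_linear f by (rule f)
  define Q where "Q w = inner w w - 2 * f w" for w
  define m where "m = (INF w\<in>V. Q w)"
  obtain B where B: "\<And>w. \<bar>f w\<bar> \<le> norm w * B"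
    using f.bounded by auto
  have "- (B\<^sup>2) \<le> Q w" for w
  proof -
    have "0 \<le> (norm w - B)\<^sup>2" by simp
    then have "- (B\<^sup>2) \<le> inner w w - 2 * (norm w * B)"
      by (simp add: power2_diff flip: power2_norm_eq_inner)
    also have "\<dots> \<le> Q w" using B[of w] by (simp add: Q_def)
    finally show ?thesis .
  qed
  then have bdd: "bdd_below (Q ` V)" by (rule bdd_belowI2)
  have ne: "V \<noteq> {}" using V(1) subspace_0 by blast
  have m_le: "m \<le> Q w" if "w \<in> V" for w
    unfolding m_def using bdd that by (rule cINF_lower)
  have "\<exists>w\<in>V. Q w < m + 1 / real (Suc n)" for n
  proof -
    have "(INF w\<in>V. Q w) < m + 1 / real (Suc n)"
      using of_nat_0_less_iff by (simp add: m_def)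
    then show ?thesis using cINF_less_iff[OF ne bdd] by blast
  qed
  then obtain s where s: "\<And>n. s n \<in> V" "\<And>n. Q (s n) < m + 1 / real (Suc n)"
    by metis
  have parallelogram: "inner (a - b) (a - b) = 2 * Q a + 2 * Q b - 4 * Q ((1/2) *\<^sub>R (a + b))" for a b
    by (simp add: Q_def f.add f.scaleR inner_add inner_diff inner_commute algebra_simps)
  have dist_le: "(dist (s p) (s q))\<^sup>2 \<le> 2 / real (Suc p) + 2 / real (Suc q)" for p q
  proof -
    have "(1/2) *\<^sub>R (s p + s q) \<in> V"
      using V(1) s(1) by (simp add: subspace_add subspace_scale)
    then have "m \<le> Q ((1/2) *\<^sub>R (s p + s q))" by (rule m_le)
    then show ?thesis
      using parallelogram[of "s p" "s q"] s(2)[of p] s(2)[of q]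
      by (simp add: dist_norm power2_norm_eq_inner)
  qed
  have "Cauchy s"
  proof (rule metric_CauchyI)
    fix e :: real assume e: "0 < e"
    obtain N where N: "4 / e\<^sup>2 < real N" using reals_Archimedean2 by blast
    have "dist (s p) (s q) < e" if "N \<le> p" "N \<le> q" for p q
    proof -
      have "0 < real N" using N e by (intro le_less_trans[OF _ N]) simp
      then have "2 / real (Suc p) + 2 / real (Suc q) < 2 / real N + 2 / real N"
        using that by (intro add_strict_mono) (auto intro!: divide_strict_left_mono)
      also have "\<dots> < e\<^sup>2" using N e \<open>0 < real N\<close> by (simp add: field_simps)
      finally have "(dist (s p) (s q))\<^sup>2 < e\<^sup>2" using dist_le[of p q] by simp
      then show ?thesis using e by (simp add: power2_less_imp_less)
    qed
    then show "\<exists>M. \<forall>m\<ge>M. \<forall>n\<ge>M. dist (s m) (s n) < e" by blast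
  qed
  then obtain v where v: "s \<longlonglongrightarrow> v" using convergentD Cauchy_convergent_iff by blast
  have vV: "v \<in> V" using closed_sequentially[OF V(2) s(1) v] .
  have "(\<lambda>n. Q (s n)) \<longlonglongrightarrow> Q v"
    unfolding Q_def by (intro tendsto_intros f.tendsto v)
  moreover have "(\<lambda>n. m + 1 / real (Suc n)) \<longlonglongrightarrow> m + 0"
    by (intro tendsto_intros LIMSEQ_inverse_real_of_nat[unfolded inverse_eq_divide])
  ultimately have Qv: "Q v \<le> m"
    using LIMSEQ_le[of "\<lambda>n. Q (s n)" "Q v" "\<lambda>n. m + 1 / real (Suc n)" "m + 0"] s(2)
    by (auto intro: less_imp_le)
  have "inner v w = f w" if w: "w \<in> V" for w
  proof -
    define d where "d = inner v w - f w"
    \<comment> \<open>Adding 1 to the optimal denominator \<open>inner w w\<close> avoids the case \<open>w = 0\<close>.\<close>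
    define t where "t = - d / (inner w w + 1)"
    have pos: "inner w w + 1 > 0" using inner_ge_zero[of w] by linarith
    have "v + t *\<^sub>R w \<in> V" using V(1) vV w by (simp add: subspace_add subspace_scale)
    then have "Q v \<le> Q (v + t *\<^sub>R w)" using m_le Qv by fastforce
    then have "0 \<le> 2 * t * d + t * t * inner w w"
      by (simp add: Q_def d_def f.add f.scaleR inner_add inner_commute algebra_simps)
    also have "\<dots> \<le> 2 * t * d + t * t * (inner w w + 1)"
      by (simp add: mult_left_mono)
    also have "\<dots> = - (d * d / (inner w w + 1))"
      using pos by (simp add: t_def divide_simps)
    finally have "d * d / (inner w w + 1) \<le> 0" by simp
    then have "d * d \<le> 0" using pos by (simp add: divide_le_0_iff)
    then have "d = 0" by (metis antisym mult_eq_0_iff zero_le_square)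
    then show ?thesis by (simp add: d_def)
  qed
  then show ?thesis using vV by blast
qed

lemma adjoint_exists:
  fixes F :: "'a::{real_inner,complete_space} \<Rightarrow> 'b::real_inner"
  assumes "bounded_linear F"
  obtains G where "bounded_linear G" "\<And>x y. inner (F x) y = inner x (G y)"
proof -
  interpret F: bounded_linear F by fact
  have "\<exists>v. \<forall>x. inner v x = inner (F x) y" for y
  proof -
    have "bounded_linear (\<lambda>x. inner (F x) y)"
      by (intro bounded_linear_compose[OF bounded_linear_inner_left assms])
    from riesz_on_closed_subspace[OF this subspace_UNIV closed_UNIV] show ?thesis by simp
  qed
  then obtain G where G: "\<And>x y. inner (G y) x = inner (F x) y" by metis
  obtain B where B: "B > 0" "\<And>x. norm (F x) \<le> norm x * B" using F.pos_bounded by blast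
  have "bounded_linear G"
  proof (rule bounded_linear_intro)
    fix y z r
    show "G (y + z) = G y + G z"
      by (rule vector_eq_rdot[THEN iffD1]) (simp add: inner_add_left inner_add_right G)
    show "G (r *\<^sub>R y) = r *\<^sub>R G y"
      by (rule vector_eq_rdot[THEN iffD1]) (simp add: G)
    have "norm (G y) * norm (G y) = inner (G y) (G y)" by (simp add: power2_norm_eq_inner flip: power2_eq_square)
    also have "\<dots> \<le> norm (F (G y)) * norm y" using G norm_cauchy_schwarz by metis
    also have "\<dots> \<le> norm (G y) * B * norm y" by (intro mult_right_mono B) simp
    finally show "norm (G y) \<le> norm y * B"
      by (cases "norm (G y) = 0") (use B in \<open>auto simp: mult_ac\<close>)
  qed
  then show ?thesis using that G by (metis inner_commute)
qed

lemma subspace_closure: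
  fixes V :: "'a::real_normed_vector set"
  assumes "subspace V"
  shows "subspace (closure V)"
proof (rule subspaceI)
  show "0 \<in> closure V" using assms closure_subset subspace_0 by blast
next
  fix x y assume x: "x \<in> closure V" and y: "y \<in> closure V"
  from x obtain f where f: "\<And>n. f n \<in> V" "f \<longlonglongrightarrow> x"
    by (auto simp: closure_sequential)
  from y obtain g where g: "\<And>n. g n \<in> V" "g \<longlonglongrightarrow> y"
    by (auto simp: closure_sequential)
  have "\<forall>n. f n + g n \<in> V" using f(1) g(1) assms by (simp add: subspace_add)
  with tendsto_add[OF f(2) g(2)] show "x + y \<in> closure V"
    unfolding closure_sequential by (intro exI[of _ "\<lambda>n. f n + g n"] conjI)
next
  fix c x assume x: "x \<in> closure V"
  then obtain f where f: "\<And>n. f n \<in> V" "f \<longlonglongrightarrow> x"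
    by (auto simp: closure_sequential)
  have "\<forall>n. c *\<^sub>R f n \<in> V" using f(1) assms by (simp add: subspace_scale)
  with tendsto_scaleR[OF tendsto_const f(2)] show "c *\<^sub>R x \<in> closure V"
    unfolding closure_sequential by (intro exI[of _ "\<lambda>n. c *\<^sub>R f n"] conjI)
qed

text \<open>
  The difference between a vector and its projection to the closure of the range is orthogonal to
  the range, hence in the kernel of the adjoint.
\<close>

lemma dense_range_if_adjoint_injective:
  fixes F :: "'a::real_inner \<Rightarrow> 'b::{real_inner,complete_space}"
  assumes F: "bounded_linear F" and adj: "\<And>x y. inner (F x) y = inner x (G y)"
    and inj: "\<And>y. G y = 0 \<Longrightarrow> y = 0"
  shows "closure (range F) = UNIV"
proof -
  have sub: "subspace (closure (range F))"
    by (intro subspace_closure linear_subspace_image bounded_linear.linear F subspace_UNIV)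
  have "y \<in> closure (range F)" for y
  proof -
    from riesz_on_closed_subspace[OF bounded_linear_inner_right[of y] sub closed_closure]
    obtain v where v: "v \<in> closure (range F)" "\<forall>w\<in>closure (range F). inner v w = inner y w" ..
    have "inner x (G (y - v)) = 0" for x
    proof -
      have "inner v (F x) = inner y (F x)"
        by (rule v(2)[rule_format, OF subsetD[OF closure_subset rangeI]])
      then show ?thesis
        by (simp add: adj[symmetric] inner_diff inner_commute)
    qed
    then have "G (y - v) = 0" using inner_eq_zero_iff[of "G (y - v)"] by simp
    then have "y = v" using inj[of "y - v"] by simp
    then show ?thesis using v(1) by simp
  qed
  then show ?thesis by blast
qed

text \<open>
  A map that is bounded below carries the complete domain to a complete, hence closed, range.
\<close>

lemma dense_range_bounded_below_surj:
  fixes F :: "'a::{real_inner,complete_space} \<Rightarrow> 'b::real_normed_vector"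
  assumes F: "bounded_linear F" and below: "\<And>x. norm x \<le> c * norm (F x)"
    and dense: "closure (range F) = UNIV"
  shows "surj F"
proof -
  \<comment> \<open>The constant \<open>c\<close> need not be positive if the domain is zero.\<close>
  define C where "C = max c 1"
  have "C > 0" by (simp add: C_def)
  have "norm x \<le> C * norm (F x)" for x
    by (rule order_trans[OF below mult_right_mono]) (auto simp: C_def)
  then have "(1 / C) * norm x \<le> norm (F x)" for x using \<open>C > 0\<close> by (simp add: field_simps)
  then have "complete (F ` UNIV)"
    using \<open>C > 0\<close> F by (intro complete_isometric_image[of "1 / C"]) (auto simp: complete_UNIV)
  then show ?thesis using dense complete_imp_closed closure_closed by blast
qed

text \<open>
  The estimate says that \<open>S\<close> factors through \<open>Y\<close>, with a Lipschitz map on the range of \<open>Y\<close>; this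
  map extends by uniform continuity, and linearity passes to the closure.
\<close>

lemma bounded_linear_extension_dense:
  fixes Y :: "'a::real_vector \<Rightarrow> 'b::real_normed_vector"
    and S :: "'a \<Rightarrow> 'c::{real_normed_vector,complete_space}"
  assumes Y: "linear Y" and S: "linear S" and le: "\<And>k. norm (S k) \<le> C * norm (Y k)"
    and dense: "closure (range Y) = UNIV"
  obtains J where "bounded_linear J" "\<And>k. J (Y k) = S k" "\<And>x. norm (J x) \<le> C * norm x"
proof -
  have dist_le: "norm (S k - S l) \<le> C * norm (Y k - Y l)" for k l
    using le[of "k - l"] by (simp add: linear_diff[OF Y] linear_diff[OF S])
  define f where "f y = S (inv Y y)" for y
  have f: "f (Y k) = S k" for k
  proof -
    have "Y (inv Y (Y k)) = Y k" by (simp add: f_inv_into_f)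
    then show ?thesis using dist_le[of "inv Y (Y k)" k] by (simp add: f_def)
  qed
  have "uniformly_continuous_on (range Y) f"
  proof (rule lipschitz_on_uniformly_continuous[of "max C 0"], rule lipschitz_onI)
    fix x y assume "x \<in> range Y" "y \<in> range Y"
    then obtain k l where [simp]: "x = Y k" "y = Y l" by blast
    have "dist (f x) (f y) \<le> C * dist x y" using dist_le by (simp add: f dist_norm)
    also have "\<dots> \<le> max C 0 * dist x y" by (intro mult_right_mono) auto
    finally show "dist (f x) (f y) \<le> max C 0 * dist x y" .
  qed simp
  then obtain J where J: "uniformly_continuous_on (closure (range Y)) J" "\<And>x. x \<in> range Y \<Longrightarrow> f x = J x"
    using uniformly_continuous_on_extension_on_closure by metis
  have cont: "continuous_on UNIV J" using J(1) dense uniformly_continuous_imp_continuous by metis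
  have cont': "continuous_on UNIV (\<lambda>x. J (g x))" if "continuous_on UNIV g" for g :: "'d::topological_space \<Rightarrow> 'b"
    using continuous_on_compose2[OF cont that] by simp
  have JY: "J (Y k) = S k" for k using J(2)[of "Y k"] f by simp
  have ext: "x \<in> A" if "closed A" "\<And>k. Y k \<in> A" for x A
    using closure_minimal[of "range Y" A] that dense by blast
  have norm: "norm (J x) \<le> C * norm x" for x
    by (rule ext[of "{x. norm (J x) \<le> C * norm x}", simplified])
      (auto intro!: closed_Collect_le continuous_intros cont simp: JY le)
  have add: "J (x + y) = J x + J y" for x y
  proof -
    have *: "J (Y k + y) = J (Y k) + J y" for k y
      by (rule ext[of "{y. J (Y k + y) = J (Y k) + J y}", simplified])
       (auto intro!: closed_Collect_eq continuous_intros cont' cont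
          simp: JY linear_add[OF S] simp flip: linear_add[OF Y])
    show ?thesis
      by (rule ext[of "{x. J (x + y) = J x + J y}", simplified])
       (auto intro!: closed_Collect_eq continuous_intros cont' cont simp: *)
  qed
  have scale: "J (r *\<^sub>R x) = r *\<^sub>R J x" for r x
    by (rule ext[of "{x. J (r *\<^sub>R x) = r *\<^sub>R J x}", simplified])
      (auto intro!: closed_Collect_eq continuous_intros cont' cont
         simp: JY linear_scale[OF S] simp flip: linear_scale[OF Y])
  have "bounded_linear J"
    by (rule bounded_linear_intro[of _ C]) (use add scale norm in \<open>auto simp: mult.commute\<close>)
  then show ?thesis using that JY norm by blast
qed

section \<open>Banach limits\<close>

definition Banach_limit :: "((nat \<Rightarrow> real) \<Rightarrow> real) \<Rightarrow> bool" where
  "Banach_limit L \<longleftrightarrow>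
    (\<forall>a b. Bseq a \<longrightarrow> Bseq b \<longrightarrow> L (\<lambda>n. a n + b n) = L a + L b) \<and>
    (\<forall>c a. Bseq a \<longrightarrow> L (\<lambda>n. c * a n) = c * L a) \<and>
    (\<forall>a. Bseq a \<longrightarrow> L (\<lambda>n. a (Suc n)) = L a) \<and>
    (\<forall>a c. Bseq a \<longrightarrow> (\<forall>n. c \<le> a n) \<longrightarrow> c \<le> L a)"

text \<open>
  The Cesaro means, evaluated on all bounded sequences at once, are points of a product of compact
  intervals.  By Tychonoff's theorem they have a cluster point \<open>L\<close>, and every closed condition
  that the means satisfy in the limit passes to \<open>L\<close>; invariance under the shift holds because the
  means of a sequence and of its shift differ by a telescoping sum divided by the length.
\<close>

lemma Banach_limit_exists: "\<exists>L. Banach_limit L"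
proof -
  define C :: "nat \<Rightarrow> (nat \<Rightarrow> real) \<Rightarrow> real" where "C N a = (\<Sum>n<Suc N. a n) / real (Suc N)" for N a
  define R where "R a = (SUP n. \<bar>a n\<bar>)" for a :: "nat \<Rightarrow> real"
  have R: "\<bar>a n\<bar> \<le> R a" if "Bseq a" for a n
    unfolding R_def using that
    by (intro cSUP_upper) (auto simp: Bseq_eq_bounded bounded_iff bdd_above_def)
  \<comment> \<open>Off the bounded sequences the value 0 keeps every coordinate in a compact set.\<close>
  define A where "A N a = (if Bseq a then C N a else 0)" for N a
  define B :: "(nat \<Rightarrow> real) \<Rightarrow> real set" where "B a = (if Bseq a then {- R a..R a} else {0})" for a
  have A_in: "A N \<in> Pi\<^sub>E UNIV B" for N
  proof -
    have "\<bar>C N a\<bar> \<le> R a" if "Bseq a" for a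
    proof -
      have "\<bar>\<Sum>n<Suc N. a n\<bar> \<le> (\<Sum>n<Suc N. R a)"
        by (rule order_trans[OF sum_abs sum_mono]) (rule R[OF that])
      then show ?thesis by (simp add: C_def abs_divide divide_le_eq mult.commute)
    qed
    then have "A N a \<in> B a" for a by (simp add: A_def B_def abs_le_iff minus_le_iff)
    then show ?thesis by (simp add: PiE_iff)
  qed
  have "compactin (product_topology (\<lambda>i. euclidean) UNIV) (Pi\<^sub>E UNIV B)"
    by (subst compactin_PiE) (auto simp: B_def)
  then have "compact (Pi\<^sub>E UNIV B)" by (simp add: euclidean_product_topology)
  moreover have "\<forall>\<^sub>F f in filtermap A sequentially. f \<in> Pi\<^sub>E UNIV B"
    using A_in by (simp add: eventually_filtermap)
  moreover have "filtermap A sequentially \<noteq> bot" by (simp add: filtermap_bot_iff)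
  ultimately obtain L where L: "inf (nhds L) (filtermap A sequentially) \<noteq> bot"
    unfolding compact_filter by blast
  define F where "F = inf (nhds L) (filtermap A sequentially)"
  have F: "F \<noteq> bot" using L by (simp add: F_def)
  have lim: "((\<lambda>f. f a) \<longlongrightarrow> L a) F" for a
  proof (rule continuous_on_tendsto_compose[OF continuous_on_product_coordinates[of a]])
    show "((\<lambda>f. f) \<longlongrightarrow> L) F" by (simp add: filterlim_def F_def)
  qed auto
  have ev: "\<forall>\<^sub>F f in F. P f" if "\<forall>\<^sub>F N in sequentially. P (A N)" for P
    using that unfolding F_def by (simp add: eventually_inf eventually_filtermap) (use eventually_True in blast)
  have "L (\<lambda>n. a n + b n) = L a + L b" if "Bseq a" "Bseq b" for a b
  proof (rule tendsto_unique[OF F lim])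
    have ab: "Bseq (\<lambda>n. a n + b n)" using that by (simp add: Bseq_eq_bounded bounded_plus_comp)
    have "\<forall>\<^sub>F f in F. f a + f b = f (\<lambda>n. a n + b n)"
      by (rule ev) (simp add: A_def that ab C_def sum.distrib add_divide_distrib)
    then show "((\<lambda>f. f (\<lambda>n. a n + b n)) \<longlongrightarrow> L a + L b) F"
      using tendsto_add[OF lim lim] by (rule Lim_transform_eventually[rotated])
  qed
  moreover have "L (\<lambda>n. c * a n) = c * L a" if "Bseq a" for a c
  proof (rule tendsto_unique[OF F lim])
    have ab: "Bseq (\<lambda>n. c * a n)" using that Bseq_cmult_iff by (cases "c = 0") auto
    have "\<forall>\<^sub>F f in F. c * f a = f (\<lambda>n. c * a n)"
      by (rule ev) (simp add: A_def that ab C_def flip: sum_distrib_left)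
    then show "((\<lambda>f. f (\<lambda>n. c * a n)) \<longlongrightarrow> c * L a) F"
      using tendsto_mult_left[OF lim] by (rule Lim_transform_eventually[rotated])
  qed
  moreover have "L (\<lambda>n. a (Suc n)) = L a" if a: "Bseq a" for a
  proof -
    have a': "Bseq (\<lambda>n. a (Suc n))" using a by (simp add: Bseq_Suc_iff)
    have diff: "A N (\<lambda>n. a (Suc n)) - A N a = (a (Suc N) - a 0) / real (Suc N)" for N
    proof -
      have "(\<Sum>n<Suc N. a (Suc n)) - (\<Sum>n<Suc N. a n) = a (Suc N) - a 0"
        by (subst sum_subtractf[symmetric]) (rule sum_lessThan_telescope)
      then show ?thesis by (simp add: A_def C_def a a' flip: diff_divide_distrib)
    qed
    have small: "L (\<lambda>n. a (Suc n)) - L a \<in> {-e..e}" if e: "e > 0" for e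
    proof (rule Lim_in_closed_set[OF _ _ F tendsto_diff[OF lim lim]])
      obtain N0 where N0: "2 * R a / e < real N0" using reals_Archimedean2 by blast
      have "\<bar>(a (Suc N) - a 0) / real (Suc N)\<bar> \<le> e" if "N \<ge> N0" for N
      proof -
        have "\<bar>a (Suc N) - a 0\<bar> \<le> 2 * R a" using R[OF a, of "Suc N"] R[OF a, of 0] by linarith
        also have "\<dots> \<le> e * real (Suc N)"
        proof -
          have "2 * R a / e \<le> real (Suc N)" using N0 that by linarith
          then show ?thesis using e by (simp add: divide_le_eq mult.commute)
        qed
        finally show ?thesis by (simp add: abs_divide divide_le_eq)
      qed
      then have "\<forall>\<^sub>F N in sequentially. A N (\<lambda>n. a (Suc n)) - A N a \<in> {-e..e}"
        unfolding diff eventually_sequentially by (intro exI[of _ N0] allI impI) (metis abs_le_D1 abs_le_D2 atLeastAtMost_iff minus_le_iff)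
      then show "\<forall>\<^sub>F f in F. f (\<lambda>n. a (Suc n)) - f a \<in> {-e..e}" by (rule ev)
    qed simp
    have "\<bar>L (\<lambda>n. a (Suc n)) - L a\<bar> \<le> 0"
      by (rule field_le_epsilon) (use small in \<open>fastforce simp: abs_le_iff\<close>)
    then show ?thesis by simp
  qed
  moreover have "c \<le> L a" if a: "Bseq a" "\<And>n. c \<le> a n" for a c
  proof -
    have "c \<le> A N a" for N
    proof -
      have "(\<Sum>n<Suc N. c) \<le> (\<Sum>n<Suc N. a n)" by (rule sum_mono) (rule a(2))
      then show ?thesis using a(1) by (simp add: A_def C_def le_divide_eq mult.commute)
    qed
    then have "\<forall>\<^sub>F f in F. f a \<in> {c..}" by (intro ev) simp
    then have "L a \<in> {c..}" by (intro Lim_in_closed_set[OF _ _ F lim]) auto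
    then show ?thesis by simp
  qed
  ultimately show ?thesis unfolding Banach_limit_def by blast
qed

lemma
  assumes "Banach_limit L" and "Bseq a"
  shows Banach_limit_add: "Bseq b \<Longrightarrow> L (\<lambda>n. a n + b n) = L a + L b"
    and Banach_limit_cmult: "L (\<lambda>n. c * a n) = c * L a"
    and Banach_limit_shift: "L (\<lambda>n. a (Suc n)) = L a"
    and Banach_limit_ge: "(\<And>n. c \<le> a n) \<Longrightarrow> c \<le> L a"
  using assms unfolding Banach_limit_def by auto

lemma Banach_limit_le:
  assumes L: "Banach_limit L" and a: "Bseq a" and le: "\<And>n. a n \<le> c"
  shows "L a \<le> c"
proof -
  have "Bseq (\<lambda>n. (-1) * a n)" using a by (simp add: Bseq_minus_iff)
  then have "- c \<le> L (\<lambda>n. (-1) * a n)" by (rule Banach_limit_ge[OF L]) (use le in simp)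
  then show ?thesis using Banach_limit_cmult[OF L a, of "-1"] by simp
qed

section \<open>Square roots of positive operators\<close>

text \<open>
  A limit \<open>Y\<close> of this iteration satisfies \<open>2 Y = B + Y\<^sup>2\<close>, that is, \<open>(1 - Y)\<^sup>2 = 1 - B\<close>.
\<close>

primrec sqrt_iterate :: "('a::real_normed_vector \<Rightarrow>\<^sub>L 'a) \<Rightarrow> nat \<Rightarrow> ('a \<Rightarrow>\<^sub>L 'a)" where
  "sqrt_iterate B 0 = 0"
| "sqrt_iterate B (Suc n) = (1/2) *\<^sub>R (B + (sqrt_iterate B n o\<^sub>L sqrt_iterate B n))"

text \<open>
  The same iteration with the number 1 in place of \<open>B\<close>; it increases to 1 and dominates the
  operator iteration step by step.
\<close>

primrec sqrt_majorant :: "nat \<Rightarrow> real" where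
  "sqrt_majorant 0 = 0"
| "sqrt_majorant (Suc n) = (1 + (sqrt_majorant n)\<^sup>2) / 2"

lemma sqrt_majorant_bounds: "0 \<le> sqrt_majorant n" "sqrt_majorant n \<le> 1"
proof -
  have "0 \<le> sqrt_majorant n \<and> sqrt_majorant n \<le> 1"
    by (induction n) (auto simp: power_le_one)
  then show "0 \<le> sqrt_majorant n" "sqrt_majorant n \<le> 1" by auto
qed

lemma norm_sqrt_iterate_le:
  assumes "norm B \<le> 1"
  shows "norm (sqrt_iterate B n) \<le> sqrt_majorant n"
proof (induction n)
  case (Suc n)
  have "norm (sqrt_iterate B n o\<^sub>L sqrt_iterate B n) \<le> (sqrt_majorant n)\<^sup>2"
    unfolding power2_eq_square
    by (rule order_trans[OF norm_blinfun_compose mult_mono]) (use Suc sqrt_majorant_bounds in auto)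
  then have "norm (B + (sqrt_iterate B n o\<^sub>L sqrt_iterate B n)) \<le> 1 + (sqrt_majorant n)\<^sup>2"
    using assms norm_triangle_ineq[of B "(sqrt_iterate B n o\<^sub>L sqrt_iterate B n)"] by linarith
  then show ?case by simp
qed simp

text \<open>
  The increments of the majorant dominate those of the iteration because
  \<open>P\<^sup>2 - Q\<^sup>2 = P (P - Q) + (P - Q) Q\<close>, where \<open>P\<close> and \<open>Q\<close> need not commute.  This gives norm
  convergence at the critical radius \<open>norm B = 1\<close>.
\<close>

lemma norm_sqrt_iterate_diff_le:
  assumes "norm B \<le> 1"
  shows "norm (sqrt_iterate B (Suc n) - sqrt_iterate B n) \<le> sqrt_majorant (Suc n) - sqrt_majorant n"
proof (induction n)
  case 0
  show ?case using norm_sqrt_iterate_le[OF assms, of "Suc 0"] by simp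
next
  case (Suc n)
  define P where "P = sqrt_iterate B (Suc n)"
  define Q where "Q = sqrt_iterate B n"
  define p where "p = sqrt_majorant (Suc n)"
  define q where "q = sqrt_majorant n"
  have IH: "norm (P - Q) \<le> p - q" using Suc by (simp only: P_def Q_def p_def q_def)
  have PQ: "norm P \<le> p" "norm Q \<le> q"
    unfolding P_def Q_def p_def q_def by (rule norm_sqrt_iterate_le[OF assms])+
  have PP: "sqrt_iterate B (Suc (Suc n)) = (1/2) *\<^sub>R (B + (P o\<^sub>L P))"
    and QQ: "P = (1/2) *\<^sub>R (B + (Q o\<^sub>L Q))"
    by (simp_all add: P_def Q_def)
  have pp: "sqrt_majorant (Suc (Suc n)) = (1 + p\<^sup>2) / 2" and qq: "p = (1 + q\<^sup>2) / 2"
    by (simp_all add: p_def q_def)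
  have "sqrt_iterate B (Suc (Suc n)) - sqrt_iterate B (Suc n)
      = (1/2) *\<^sub>R (B + (P o\<^sub>L P)) - (1/2) *\<^sub>R (B + (Q o\<^sub>L Q))"
    by (simp only: PP QQ[symmetric] P_def[symmetric])
  also have "\<dots> = (1/2) *\<^sub>R ((P o\<^sub>L P) - (Q o\<^sub>L Q))"
    by (simp add: algebra_simps)
  also have "(P o\<^sub>L P) - (Q o\<^sub>L Q) = (P o\<^sub>L (P - Q)) + ((P - Q) o\<^sub>L Q)"
    by (rule blinfun_eqI) (simp add: blinfun.bilinear_simps)
  also have "norm ((1/2) *\<^sub>R ((P o\<^sub>L (P - Q)) + ((P - Q) o\<^sub>L Q))) \<le> (1/2) * (p * (p - q) + (p - q) * q)"
  proof -
    have "norm (P o\<^sub>L (P - Q)) \<le> p * (p - q)"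
      by (rule order_trans[OF norm_blinfun_compose mult_mono]) (use IH PQ norm_ge_zero[of P] norm_ge_zero[of "P - Q"] in linarith)+
    moreover have "norm ((P - Q) o\<^sub>L Q) \<le> (p - q) * q"
      by (rule order_trans[OF norm_blinfun_compose mult_mono]) (use IH PQ norm_ge_zero[of Q] norm_ge_zero[of "P - Q"] in linarith)+
    ultimately show ?thesis
      by (simp add: order_trans[OF norm_triangle_ineq])
  qed
  also have "\<dots> = (1 + p\<^sup>2) / 2 - (1 + q\<^sup>2) / 2"
    by (simp add: field_simps power2_eq_square)
  also have "\<dots> = sqrt_majorant (Suc (Suc n)) - sqrt_majorant (Suc n)"
    by (simp only: pp qq[symmetric] p_def[symmetric])
  finally show ?case .
qed

lemma sqrt_iterate_convergent:
  fixes B :: "'a::banach \<Rightarrow>\<^sub>L 'a"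
  assumes "norm B \<le> 1"
  shows "convergent (sqrt_iterate B)"
proof -
  have step: "sqrt_majorant n \<le> sqrt_majorant (Suc n)" for n
    using order_trans[OF norm_ge_zero norm_sqrt_iterate_diff_le[OF assms, of n]] by simp
  have "incseq sqrt_majorant" by (rule incseq_SucI) (rule step)
  then have "Cauchy sqrt_majorant"
    using sqrt_majorant_bounds(2) incseq_convergent LIMSEQ_imp_Cauchy by metis
  have le: "norm (sqrt_iterate B (n + k) - sqrt_iterate B n) \<le> sqrt_majorant (n + k) - sqrt_majorant n" for n k
  proof (induction k)
    case (Suc k)
    have "norm (sqrt_iterate B (n + Suc k) - sqrt_iterate B n)
      \<le> norm (sqrt_iterate B (Suc (n + k)) - sqrt_iterate B (n + k)) + norm (sqrt_iterate B (n + k) - sqrt_iterate B n)"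
      by (metis add_Suc_right diff_add_cancel add_diff_eq norm_triangle_ineq)
    then show ?case using Suc norm_sqrt_iterate_diff_le[OF assms, of "n + k"] by simp
  qed simp
  have "Cauchy (sqrt_iterate B)"
  proof (rule CauchyI')
    fix e :: real assume "0 < e"
    then obtain N where N: "\<And>m n. m \<ge> N \<Longrightarrow> n \<ge> N \<Longrightarrow> norm (sqrt_majorant m - sqrt_majorant n) < e"
      using \<open>Cauchy sqrt_majorant\<close> unfolding Cauchy_iff by blast
    have "norm (sqrt_iterate B m - sqrt_iterate B n) < e" if "m \<ge> N" "n > m" for m n
      using le[of m "n - m"] N[of n m] that by (simp add: norm_minus_commute)
    then show "\<exists>M. \<forall>m\<ge>M. \<forall>n>m. dist (sqrt_iterate B m) (sqrt_iterate B n) < e"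
      unfolding dist_norm by blast
  qed
  then show ?thesis by (simp add: Cauchy_convergent_iff)
qed

text \<open>
  Scaling to \<open>0 \<le> D \<le> 1\<close> reduces the claim to the iteration with \<open>B = 1 - D\<close>.  Symmetry and
  commutation hold for every iterate and pass to the limit.
\<close>

lemma selfadjoint_sqrt:
  fixes A :: "'a::{real_inner,banach} \<Rightarrow> 'a"
  assumes A: "bounded_linear A" and sym: "\<And>x y. inner (A x) y = inner x (A y)"
    and pos: "\<And>x. 0 \<le> inner (A x) x"
  obtains S where "bounded_linear S" "\<And>x y. inner (S x) y = inner x (S y)" "\<And>x. S (S x) = A x"
    "\<And>V x. linear V \<Longrightarrow> continuous_on UNIV V \<Longrightarrow> (\<And>x. V (A x) = A (V x)) \<Longrightarrow> V (S x) = S (V x)"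
proof -
  interpret A: bounded_linear A by (rule A)
  obtain c where c: "c > 0" "\<And>x. norm (A x) \<le> norm x * c" using A.pos_bounded by blast
  define D where "D x = (1 / c) *\<^sub>R A x" for x
  have D: "bounded_linear D" unfolding D_def by (intro bounded_linear_scaleR_right bounded_linear_compose[OF _ A])
  interpret D: bounded_linear D by (rule D)
  have Dsym: "inner (D x) y = inner x (D y)" for x y by (simp add: D_def sym)
  have Dle: "norm (D x) \<le> norm x" for x
    using c by (simp add: D_def divide_le_eq mult.commute)
  \<comment> \<open>Positivity of \<open>D\<close> at \<open>x - D x\<close> yields \<open>D\<^sup>2 \<le> D\<close>, and with it \<open>norm (1 - D) \<le> 1\<close>.\<close>
  have DD: "inner (D x) (D x) \<le> inner (D x) x" for x
  proof -
    have "0 \<le> inner (D (x - D x)) (x - D x)" using pos c(1) by (simp add: D_def)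
    also have "\<dots> = inner (D x) x - 2 * inner (D x) (D x) + inner (D (D x)) (D x)"
      using Dsym[of "D x" x] by (simp add: D.diff inner_diff inner_commute)
    also have "inner (D (D x)) (D x) \<le> norm (D x) * norm (D x)"
      by (rule order_trans[OF norm_cauchy_schwarz]) (simp add: Dle mult_right_mono)
    also have "norm (D x) * norm (D x) = inner (D x) (D x)"
      by (simp add: power2_norm_eq_inner flip: power2_eq_square)
    finally show ?thesis by simp
  qed
  define B where "B = Blinfun (\<lambda>x. x - D x)"
  have B: "blinfun_apply B x = x - D x" for x
    unfolding B_def by (subst bounded_linear_Blinfun_apply) (auto intro: bounded_linear_sub D bounded_linear_ident)
  have "norm B \<le> 1"
  proof (rule norm_blinfun_bound)
    fix x
    have "0 \<le> inner (D x) x" using pos[of x] c(1) by (simp add: D_def)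
    then have "(norm (x - D x))\<^sup>2 \<le> (norm x)\<^sup>2"
      using DD[of x] by (simp add: power2_norm_eq_inner inner_diff inner_commute)
    then have "norm (x - D x) \<le> norm x" by (rule power2_le_imp_le) simp
    then show "norm (blinfun_apply B x) \<le> 1 * norm x" by (simp add: B)
  qed simp
  then obtain Y where Y: "sqrt_iterate B \<longlonglongrightarrow> Y"
    using sqrt_iterate_convergent[of B] by (auto simp: convergent_def)
  have Yx: "(\<lambda>n. sqrt_iterate B n (f n)) \<longlonglongrightarrow> Y y" if "f \<longlonglongrightarrow> y" for f y
    by (rule blinfun.tendsto[OF Y that])
  have fixpoint: "Y x = (1/2) *\<^sub>R (x - D x + Y (Y x))" for x
  proof (rule LIMSEQ_unique)
    show "(\<lambda>n. sqrt_iterate B (Suc n) x) \<longlonglongrightarrow> Y x"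
      using LIMSEQ_Suc[OF Yx[OF tendsto_const]] by simp
    have "(\<lambda>n. (1/2) *\<^sub>R (x - D x + sqrt_iterate B n (sqrt_iterate B n x))) \<longlonglongrightarrow> (1/2) *\<^sub>R (x - D x + Y (Y x))"
      by (intro tendsto_scaleR tendsto_add tendsto_const Yx[OF Yx[OF tendsto_const]])
    then show "(\<lambda>n. sqrt_iterate B (Suc n) x) \<longlonglongrightarrow> (1/2) *\<^sub>R (x - D x + Y (Y x))"
      by (simp add: blinfun.bilinear_simps B)
  qed
  have Ysym: "inner (Y x) y = inner x (Y y)" for x y
  proof (rule LIMSEQ_unique)
    have *: "inner (sqrt_iterate B n x) y = inner x (sqrt_iterate B n y)" for n x y
      by (induction n arbitrary: x y) (simp_all add: blinfun.bilinear_simps B inner_add inner_diff Dsym)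
    show "(\<lambda>n. inner (sqrt_iterate B n x) y) \<longlonglongrightarrow> inner (Y x) y"
      by (intro tendsto_inner Yx[OF tendsto_const] tendsto_const)
    show "(\<lambda>n. inner (sqrt_iterate B n x) y) \<longlonglongrightarrow> inner x (Y y)" 
      unfolding * by (intro tendsto_inner Yx[OF tendsto_const] tendsto_const)
  qed
  have Ycomm: "V (Y x) = Y (V x)"
    if V: "linear V" "continuous_on UNIV V" and VA: "\<And>x. V (A x) = A (V x)" for V x
  proof (rule LIMSEQ_unique)
    have *: "V (sqrt_iterate B n x) = sqrt_iterate B n (V x)" for n x
      by (induction n arbitrary: x)
        (simp_all add: blinfun.bilinear_simps B linear_0[OF V(1)] linear_add[OF V(1)] linear_diff[OF V(1)]
            linear_scale[OF V(1)] D_def VA)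
    show "(\<lambda>n. V (sqrt_iterate B n x)) \<longlonglongrightarrow> V (Y x)"
      by (rule continuous_on_tendsto_compose[OF V(2) Yx[OF tendsto_const]]) auto
    show "(\<lambda>n. V (sqrt_iterate B n x)) \<longlonglongrightarrow> Y (V x)" unfolding * by (rule Yx[OF tendsto_const])
  qed
  define S where "S x = sqrt c *\<^sub>R (x - Y x)" for x
  show ?thesis
  proof (rule that)
    show "bounded_linear S" unfolding S_def
      by (intro bounded_linear_scaleR_right bounded_linear_compose[OF bounded_linear_scaleR_right]
          bounded_linear_sub bounded_linear_ident blinfun.bounded_linear_right)
    show "inner (S x) y = inner x (S y)" for x y
      by (simp add: S_def inner_diff Ysym)
    have "2 *\<^sub>R Y x = x - D x + Y (Y x)" for x 
      using arg_cong[OF fixpoint[of x], of "(*\<^sub>R) 2"] by simp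
    then have YY: "Y (Y x) = 2 *\<^sub>R Y x - x + D x" for x by (simp add: algebra_simps)
    have "S (S x) = c *\<^sub>R (x - Y x - (Y x - Y (Y x)))" for x
      using c(1) by (simp add: S_def blinfun.bilinear_simps scaleR_diff_right)
    moreover have "x - Y x - (Y x - Y (Y x)) = D x" for x
      by (simp add: YY scaleR_2)
    ultimately show "S (S x) = A x" for x
      using c(1) by (simp add: D_def)
    show "V (S x) = S (V x)"
      if V: "linear V" "continuous_on UNIV V" and VA: "\<And>x. V (A x) = A (V x)" for V x
      by (simp add: S_def linear_diff[OF V(1)] linear_scale[OF V(1)] Ycomm[OF V VA])
  qed
qed

text \<open>
  The operator \<open>S\<close> is the square root of the operator that represents \<open>b\<close>.  A surjective isometry
  that leaves \<open>b\<close> invariant commutes with that operator, hence with \<open>S\<close>; this will be used both for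
  the unitary operator and for multiplication by \<open>\<i>\<close>.
\<close>

lemma positive_form_factorization:
  fixes b :: "'a::{real_inner,banach} \<Rightarrow> 'a \<Rightarrow> real"
  assumes b: "bounded_bilinear b" and sym: "\<And>x y. b x y = b y x" and pos: "\<And>x. 0 \<le> b x x"
  obtains S where "bounded_linear S" "\<And>x y. inner (S x) y = inner x (S y)"
    "\<And>x y. b x y = inner (S x) (S y)"
    "\<forall>V. linear V \<longrightarrow> surj V \<longrightarrow> (\<forall>x y. inner (V x) (V y) = inner x y) \<longrightarrow>
      (\<forall>x y. b (V x) (V y) = b x y) \<longrightarrow> (\<forall>x. V (S x) = S (V x))"
proof -
  interpret b: bounded_bilinear b by (rule b)
  have "\<exists>v. \<forall>y. inner v y = b x y" for x
    using riesz_on_closed_subspace[OF b.bounded_linear_right[of x] subspace_UNIV closed_UNIV] by simp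
  then obtain A where A: "\<And>x y. inner (A x) y = b x y" by metis
  obtain B where B: "B > 0" "\<And>x y. \<bar>b x y\<bar> \<le> norm x * norm y * B"
    using b.pos_bounded by auto
  have "bounded_linear A"
  proof (rule bounded_linear_intro)
    fix x y r
    show "A (x + y) = A x + A y"
      by (rule vector_eq_rdot[THEN iffD1]) (simp add: inner_add_left A b.add_left)
    show "A (r *\<^sub>R x) = r *\<^sub>R A x"
      by (rule vector_eq_rdot[THEN iffD1]) (simp add: A b.scaleR_left)
    have "norm (A x) * norm (A x) = b x (A x)" by (simp add: A[symmetric] power2_norm_eq_inner flip: power2_eq_square)
    also have "\<dots> \<le> norm x * norm (A x) * B" using B(2) abs_le_D1 by blast
    finally show "norm (A x) \<le> norm x * B"
      by (cases "norm (A x) = 0") (use B in \<open>auto simp: mult_ac\<close>)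
  qed
  moreover have Asym: "inner (A x) y = inner x (A y)" for x y using A sym by (metis inner_commute)
  moreover have "0 \<le> inner (A x) x" for x by (simp add: A pos)
  ultimately obtain S where S: "bounded_linear S" "\<And>x y. inner (S x) y = inner x (S y)" "\<And>x. S (S x) = A x"
    "\<And>V x. linear V \<Longrightarrow> continuous_on UNIV V \<Longrightarrow> (\<And>x. V (A x) = A (V x)) \<Longrightarrow> V (S x) = S (V x)"
    using selfadjoint_sqrt by metis
  show ?thesis
  proof (rule that)
    show "bounded_linear S" "\<And>x y. inner (S x) y = inner x (S y)" by (rule S)+
    show "b x y = inner (S x) (S y)" for x y by (metis A S(2,3))
    have "V (S x) = S (V x)" if V: "linear V" "surj V" "\<forall>x y. inner (V x) (V y) = inner x y"
      "\<forall>x y. b (V x) (V y) = b x y" for V x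
    proof (rule S(4)[OF V(1)])
      have "bounded_linear V"
        by (rule bounded_linear_intro[of _ 1])
          (use V(3) in \<open>auto simp: linear_add[OF V(1)] linear_scale[OF V(1)] norm_eq_sqrt_inner\<close>)
      then show "continuous_on UNIV V" by (rule linear_continuous_on)
      show "V (A x) = A (V x)" for x
      proof -
        have "inner (V (A x)) z = inner (A (V x)) z" for z
          using V(2-4) A by (metis surjD)
        then show ?thesis using vector_eq_rdot by blast
      qed
    qed
    then show "\<forall>V. linear V \<longrightarrow> surj V \<longrightarrow> (\<forall>x y. inner (V x) (V y) = inner x y) \<longrightarrow>
      (\<forall>x y. b (V x) (V y) = b x y) \<longrightarrow> (\<forall>x. V (S x) = S (V x))" by blast
  qed
qed

section \<open>Complex linearity and the complex inner product\<close>

instance complex_hilbert_space \<subseteq> banach ..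

lemma norm_scaleC: "norm (c *\<^sub>C x) = cmod c * norm (x::'a::complex_hilbert_space)"
proof -
  have "cinner (c *\<^sub>C x) (c *\<^sub>C x) = c * cnj (c * cinner x x)"
    by (metis cinner_commute cinner_scaleC_left)
  also have "\<dots> = complex_of_real ((cmod c)\<^sup>2) * cinner x x"
    by (simp only: complex_cnj_mult cinner_commute[of x x, symmetric] complex_norm_square mult.assoc)
  finally have "inner (c *\<^sub>C x) (c *\<^sub>C x) = (cmod c)\<^sup>2 * inner x x"
    by (simp add: inner_eq_Re_cinner)
  then show ?thesis by (simp add: norm_eq_sqrt_inner real_sqrt_mult)
qed

lemma bounded_linear_scaleC: "bounded_linear (\<lambda>x::'a::complex_hilbert_space. c *\<^sub>C x)"
  by (rule bounded_linear_intro[of _ "cmod c"])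
    (simp_all add: scaleC_add_right norm_scaleC scaleR_scaleC scaleC_scaleC mult.commute)

lemma scaleC_zero: "c *\<^sub>C 0 = (0::'a::complex_hilbert_space)"
  by (rule linear_0) (rule bounded_linear.linear[OF bounded_linear_scaleC])

lemma scaleC_diff_right: "c *\<^sub>C (x - y) = c *\<^sub>C x - c *\<^sub>C (y::'a::complex_hilbert_space)"
  by (rule linear_diff) (rule bounded_linear.linear[OF bounded_linear_scaleC])

lemma inner_scaleC_imaginary:
  "inner (\<i> *\<^sub>C x) (\<i> *\<^sub>C y) = inner x (y::'a::complex_hilbert_space)"
proof -
  have "cinner (\<i> *\<^sub>C x) (\<i> *\<^sub>C y) = \<i> * cnj (\<i> * cinner y x)"
    by (metis cinner_commute cinner_scaleC_left)
  also have "\<dots> = cnj (cinner y x)" by simp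
  also have "\<dots> = cinner x y" using cinner_commute[of x y] by simp
  finally show ?thesis by (simp add: inner_eq_Re_cinner)
qed

text \<open>
  Real linearity is inherited from the real theory above, so complex linearity only has to be
  checked for the scalar \<open>\<i>\<close>.
\<close>

lemma bounded_clinearI:
  assumes f: "bounded_linear f" and i: "\<And>x. f (\<i> *\<^sub>C x) = \<i> *\<^sub>C f x"
  shows "bounded_clinear f"
proof -
  interpret bounded_linear f by (rule f)
  have "f (c *\<^sub>C x) = c *\<^sub>C f x" for c x
  proof -
    have c: "c *\<^sub>C y = Re c *\<^sub>R y + Im c *\<^sub>R (\<i> *\<^sub>C y)" for y :: "'c::complex_hilbert_space"
      by (simp add: scaleR_scaleC scaleC_scaleC flip: scaleC_add_left) (metis complex_eq mult.commute)
    show ?thesis by (simp add: c add scaleR i)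
  qed
  then show ?thesis using f by (simp add: bounded_clinear_def)
qed

lemma bounded_linear_funpow:
  fixes f :: "'a::real_normed_vector \<Rightarrow> 'a"
  assumes "bounded_linear f"
  shows "bounded_linear (f ^^ n)"
proof (induction n)
  case 0
  show ?case by (simp add: id_def bounded_linear_ident)
next
  case (Suc n)
  show ?case using bounded_linear_compose[OF assms Suc] by (simp add: o_def)
qed

lemma bounded_clinear_funpow:
  fixes f :: "'a::complex_hilbert_space \<Rightarrow> 'a"
  assumes "bounded_clinear f"
  shows "bounded_clinear (f ^^ n)"
proof -
  have "(f ^^ n) (c *\<^sub>C x) = c *\<^sub>C (f ^^ n) x" for c x
    using assms by (induction n) (auto simp: bounded_clinear_def)
  then show ?thesis using assms bounded_linear_funpow[of f n] by (simp add: bounded_clinear_def)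
qed

text \<open>
  Here \<open>G\<close> is only known to be the adjoint for the real inner product.  Rotating \<open>x\<close> by a scalar of
  modulus 1 makes \<open>cinner (J x) y\<close> real and nonnegative, and then it is a real inner product.
\<close>

lemma cmod_cinner_adjoint_le:
  assumes J: "bounded_clinear J" and G: "\<And>x y. inner (J x) y = inner x (G y)"
  shows "cmod (cinner (J x) y) \<le> norm x * norm (G y)"
proof -
  define c where "c = cinner (J x) y"
  define u where "u = cnj (sgn c)"
  have "u * c = c * cnj c / complex_of_real (cmod c)" by (simp add: u_def sgn_eq)
  also have "\<dots> = complex_of_real ((cmod c)\<^sup>2) / complex_of_real (cmod c)"
    by (simp only: complex_norm_square)
  also have "\<dots> = complex_of_real (cmod c)" by (simp add: power2_eq_square)
  finally have "u * c = complex_of_real (cmod c)" .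
  then have "cmod c = Re (cinner (u *\<^sub>C J x) y)" by (simp add: c_def cinner_scaleC_left)
  also have "\<dots> = inner (J (u *\<^sub>C x)) y"
    using J by (simp add: inner_eq_Re_cinner bounded_clinear_def)
  also have "\<dots> = inner (u *\<^sub>C x) (G y)" by (rule G)
  also have "\<dots> \<le> norm (u *\<^sub>C x) * norm (G y)" by (rule norm_cauchy_schwarz)
  finally have "cmod c \<le> norm (u *\<^sub>C x) * norm (G y)" .
  moreover have "norm (u *\<^sub>C x) \<le> norm x"
    unfolding norm_scaleC by (rule mult_left_le_one_le) (simp_all add: u_def norm_sgn)
  then have "norm (u *\<^sub>C x) * norm (G y) \<le> norm x * norm (G y)" by (rule mult_right_mono) simp
  ultimately show ?thesis by (simp add: c_def)
qed

lemma cinner_add_right: "cinner x (y + z) = cinner x y + cinner x z"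
  by (metis cinner_add_left cinner_commute complex_cnj_add)

lemma cinner_scaleC_right: "cinner x (c *\<^sub>C y) = cnj c * cinner x y"
  by (metis cinner_commute cinner_scaleC_left complex_cnj_mult)

lemma cinner_minus_left: "cinner (- x) y = - cinner x y"
  using cinner_scaleC_left[of "-1" x y] by (metis mult_minus1 scaleR_minus1_left scaleR_scaleC of_real_minus of_real_1)

lemma cinner_minus_right: "cinner x (- y) = - cinner x y"
  by (metis cinner_commute cinner_minus_left complex_cnj_minus)

lemma cinner_diff_left: "cinner (x - y) z = cinner x z - cinner y z"
  using cinner_add_left[of x "- y" z] by (simp add: cinner_minus_left)

lemma cinner_diff_right: "cinner x (y - z) = cinner x y - cinner x z"
  using cinner_add_right[of x y "- z"] by (simp add: cinner_minus_right)

lemma cinner_zero_left: "cinner 0 y = 0"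
  using cinner_diff_left[of 0 0 y] by simp

lemma cinner_sum_left: "cinner (\<Sum>i\<in>I. f i) y = (\<Sum>i\<in>I. cinner (f i) y)"
  by (induction I rule: infinite_finite_induct) (simp_all add: cinner_add_left cinner_zero_left)

lemma cinner_self: "cinner x x = complex_of_real ((norm x)\<^sup>2)"
proof (rule complex_eqI)
  show "Re (cinner x x) = Re (complex_of_real ((norm x)\<^sup>2))"
    by (simp add: power2_norm_eq_inner inner_eq_Re_cinner)
  show "Im (cinner x x) = Im (complex_of_real ((norm x)\<^sup>2))"
    using arg_cong[OF cinner_commute[of x x], of Im] by simp
qed

lemma bounded_clinear_ident: "bounded_clinear (\<lambda>x. x)"
  by (simp add: bounded_clinear_def bounded_linear_ident)

lemma cmod_cinner_le: "cmod (cinner x y) \<le> norm x * norm y"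
  by (rule cmod_cinner_adjoint_le[OF bounded_clinear_ident]) simp

lemma tendsto_cinner_left:
  assumes "(f \<longlongrightarrow> x) F"
  shows "((\<lambda>n. cinner (f n) y) \<longlongrightarrow> cinner x y) F"
proof (rule Lim_null[THEN iffD2], rule Lim_null_comparison)
  show "\<forall>\<^sub>F n in F. norm (cinner (f n) y - cinner x y) \<le> norm (f n - x) * norm y"
    by (simp add: cmod_cinner_le flip: cinner_diff_left)
  show "((\<lambda>n. norm (f n - x) * norm y) \<longlongrightarrow> 0) F"
    using tendsto_mult_left_zero[OF tendsto_norm_zero[OF Lim_null[THEN iffD1, OF assms]], of "norm y"] .
qed

lemma scaleC_sum_right: "c *\<^sub>C (\<Sum>i\<in>I. f i) = (\<Sum>i\<in>I. c *\<^sub>C f i)"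
  by (rule linear_sum) (rule bounded_linear.linear[OF bounded_linear_scaleC])

text \<open>
  Polarization expresses \<open>cinner (D x) y\<close> by four values of the quadratic form; the estimate
  follows with \<open>y\<close> the multiple of \<open>D x\<close> that has the norm of \<open>x\<close>.
\<close>

lemma norm_le_numerical_radius:
  fixes D :: "'a::complex_hilbert_space \<Rightarrow> 'a"
  assumes D: "bounded_clinear D" and e: "\<And>x. cmod (cinner (D x) x) \<le> e * (norm x)\<^sup>2"
  shows "norm (D x) \<le> 2 * e * norm x"
proof -
  have linear: "linear D" and DC: "\<And>c x. D (c *\<^sub>C x) = c *\<^sub>C D x"
    using D by (auto simp: bounded_clinear_def bounded_linear.linear)
  define q where "q x = cinner (D x) x" for x
  have parallelogram: "(norm (x + w))\<^sup>2 + (norm (x - w))\<^sup>2 = 2 * (norm x)\<^sup>2 + 2 * (norm w)\<^sup>2" for x w :: 'a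
    by (simp add: power2_norm_eq_inner inner_add inner_diff inner_commute)
  have polar: "cmod (cinner (D x) y) \<le> e * ((norm x)\<^sup>2 + (norm y)\<^sup>2)" for x y
  proof -
    define z where "z = \<i> *\<^sub>C y"
    have Dz: "D z = \<i> *\<^sub>C D y" and cz: "cinner w z = - \<i> * cinner w y" "norm z = norm y" for w
      by (simp_all add: z_def DC cinner_scaleC_right norm_scaleC)
    have "4 * cinner (D x) y = (q (x + y) - q (x - y)) + \<i> * (q (x + z) - q (x - z))"
      by (simp add: q_def linear_add[OF linear] linear_diff[OF linear] Dz cz cinner_scaleC_left
          cinner_add_left cinner_add_right cinner_diff_left cinner_diff_right algebra_simps)
    then have "4 * cmod (cinner (D x) y) = cmod ((q (x + y) - q (x - y)) + \<i> * (q (x + z) - q (x - z)))"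
      by (metis norm_mult norm_numeral)
    also have "\<dots> \<le> (cmod (q (x + y)) + cmod (q (x - y))) + (cmod (q (x + z)) + cmod (q (x - z)))"
      by (intro order_trans[OF norm_triangle_ineq] add_mono norm_triangle_ineq4)
        (simp add: norm_mult norm_triangle_ineq4)
    also have "\<dots> \<le> (e * (norm (x + y))\<^sup>2 + e * (norm (x - y))\<^sup>2) + (e * (norm (x + z))\<^sup>2 + e * (norm (x - z))\<^sup>2)"
      unfolding q_def by (intro add_mono e)
    also have "\<dots> = e * (((norm (x + y))\<^sup>2 + (norm (x - y))\<^sup>2) + ((norm (x + z))\<^sup>2 + (norm (x - z))\<^sup>2))"
      by (simp add: algebra_simps)
    also have "\<dots> = 4 * (e * ((norm x)\<^sup>2 + (norm y)\<^sup>2))"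
      unfolding parallelogram cz by (simp add: algebra_simps)
    finally show ?thesis by simp
  qed
  show ?thesis
  proof (cases "D x = 0 \<or> x = 0")
    case True
    have "0 \<le> e * (norm x)\<^sup>2" using e[of x] order_trans norm_ge_zero by blast
    then have "0 \<le> e * norm x"
      by (cases "x = 0") (auto simp: zero_le_mult_iff)
    then show ?thesis using True linear_0[OF linear] by auto
  next
    case False
    define t where "t = norm x / norm (D x)"
    have "cmod (cinner (D x) (t *\<^sub>R D x)) = norm x * norm (D x)"
      using False by (simp add: scaleR_scaleC cinner_scaleC_right cinner_self norm_mult t_def power2_eq_square)
    moreover have "norm (t *\<^sub>R D x) = norm x" using False by (simp add: t_def)
    ultimately have "norm x * norm (D x) \<le> norm x * (2 * e * norm x)"
      using polar[of x "t *\<^sub>R D x"] by (simp add: power2_eq_square algebra_simps)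
    then show ?thesis using False by simp
  qed
qed

section \<open>The isometric asymptote\<close>

lemma intertwining_funpow:
  assumes "\<And>x. X (T x) = U (X x)"
  shows "X ((T ^^ n) x) = (U ^^ n) (X x)"
  by (induction n) (simp_all add: assms)

lemma closed_dense_UNIV:
  assumes "closed {x. P x}" and "closure A = UNIV" and "\<And>x. x \<in> A \<Longrightarrow> P x"
  shows "P x"
proof -
  have "closure A \<subseteq> {x. P x}" by (rule closure_minimal) (use assms in auto)
  then show ?thesis using assms(2) by auto
qed

text \<open>
  The operator \<open>J\<close> satisfies \<open>(norm (J x))\<^sup>2 = L (\<lambda>n. (norm (T\<^sup>n x))\<^sup>2)\<close> for a Banach limit \<open>L\<close>.
  If all norms \<open>norm (T\<^sup>n x)\<close> were at least \<open>norm (J x) + e\<close>, so would be the limit; this gives the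
  fourth property.  The operator \<open>S = J Y\<close> is kept because its symmetry shows that the range of
  \<open>J\<close> is dense.
\<close>

lemma isometric_asymptote:
  fixes T :: "'h::complex_hilbert_space \<Rightarrow> 'h" and U :: "'k::complex_hilbert_space \<Rightarrow> 'k"
  assumes T: "bounded_clinear T" and M: "0 \<le> M" "\<And>n x. norm ((T ^^ n) x) \<le> M * norm x"
    and Y: "bounded_clinear Y" "closure (range Y) = UNIV" "\<And>k. Y (U k) = T (Y k)"
    and U: "bounded_clinear U" "surj U" "\<And>k l. inner (U k) (U l) = inner k l"
  obtains J S where "bounded_clinear J" "\<And>x. norm (J x) \<le> M * norm x" "\<And>x. J (T x) = U (J x)"
    "\<And>x e. 0 < e \<Longrightarrow> \<exists>n. norm ((T ^^ n) x) < norm (J x) + e"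
    "bounded_linear S" "\<And>k l. inner (S k) l = inner k (S l)" "\<And>k. J (Y k) = S k"
proof -
  obtain L where L: "Banach_limit L" using Banach_limit_exists by blast
  interpret Y: bounded_linear Y using Y(1) by (simp add: bounded_clinear_def)
  interpret T: bounded_linear T using T by (simp add: bounded_clinear_def)
  have Tn: "bounded_linear (T ^^ n)" for n by (rule bounded_linear_funpow) (rule T.bounded_linear_axioms)
  have TnC: "(T ^^ n) (c *\<^sub>C x) = c *\<^sub>C (T ^^ n) x" for n c x
    using bounded_clinear_funpow[OF T] by (simp add: bounded_clinear_def)
  have YC: "Y (c *\<^sub>C x) = c *\<^sub>C Y x" for c x using Y(1) by (simp add: bounded_clinear_def)
  define s where "s k l n = inner ((T ^^ n) (Y k)) ((T ^^ n) (Y l))" for k l n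
  define b where "b k l = L (s k l)" for k l
  have s_le: "\<bar>s k l n\<bar> \<le> M\<^sup>2 * (norm (Y k) * norm (Y l))" for k l n
  proof -
    have "\<bar>s k l n\<bar> \<le> norm ((T ^^ n) (Y k)) * norm ((T ^^ n) (Y l))"
      unfolding s_def by (rule Cauchy_Schwarz_ineq2)
    also have "\<dots> \<le> (M * norm (Y k)) * (M * norm (Y l))"
      by (intro mult_mono M) (use M(1) in auto)
    finally show ?thesis by (simp add: power2_eq_square mult_ac)
  qed
  have s: "Bseq (s k l)" for k l
    by (rule BseqI'[of _ "M\<^sup>2 * (norm (Y k) * norm (Y l))"]) (simp add: s_le)
  have s_add: "s (k + k') l = (\<lambda>n. s k l n + s k' l n)" for k k' l
    by (rule ext) (simp add: s_def Y.add bounded_linear.linear[OF Tn, THEN linear_add] inner_add_left)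
  have s_scale: "s (r *\<^sub>R k) l = (\<lambda>n. r * s k l n)" for r k l
    by (rule ext) (simp add: s_def Y.scaleR bounded_linear.linear[OF Tn, THEN linear_scale])
  have "s k l = s l k" for k l by (rule ext) (simp add: s_def inner_commute)
  then have b_sym: "b k l = b l k" for k l by (simp add: b_def)
  have b_add: "b (k + k') l = b k l + b k' l" for k k' l
    unfolding b_def s_add by (rule Banach_limit_add[OF L s s])
  have b_scale: "b (r *\<^sub>R k) l = r * b k l" for r k l
    unfolding b_def s_scale by (rule Banach_limit_cmult[OF L s])
  have b_le: "b k l \<le> M\<^sup>2 * (norm (Y k) * norm (Y l))" for k l
    unfolding b_def using abs_le_D1[OF s_le] by (rule Banach_limit_le[OF L s])
  have b_ge: "- (M\<^sup>2 * (norm (Y k) * norm (Y l))) \<le> b k l" for k l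
    unfolding b_def by (rule Banach_limit_ge[OF L s]) (use abs_le_D2[OF s_le] in \<open>simp add: minus_le_iff\<close>)
  have b: "bounded_bilinear b"
  proof
    show "b (k + k') l = b k l + b k' l" for k k' l by (rule b_add)
    show "b k (l + l') = b k l + b k l'" for k l l' using b_add b_sym by metis
    show "b (r *\<^sub>R k) l = r *\<^sub>R b k l" for r k l by (simp add: b_scale)
    show "b k (r *\<^sub>R l) = r *\<^sub>R b k l" for r k l using b_scale b_sym by (metis real_scaleR_def)
    obtain B where B: "0 < B" "\<And>k. norm (Y k) \<le> norm k * B" using Y.pos_bounded by blast
    have "norm (b k l) \<le> norm k * norm l * (M\<^sup>2 * B\<^sup>2)" for k l
    proof -
      have "norm (b k l) \<le> M\<^sup>2 * (norm (Y k) * norm (Y l))"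
        using b_le[of k l] b_ge[of k l] by (simp add: abs_le_iff)
      also have "\<dots> \<le> M\<^sup>2 * ((norm k * B) * (norm l * B))"
        by (intro mult_left_mono mult_mono B(2)) (use B(1) in auto)
      finally show ?thesis by (simp add: power2_eq_square mult_ac)
    qed
    then show "\<exists>K. \<forall>k l. norm (b k l) \<le> norm k * norm l * K" by blast
  qed
  have b_pos: "0 \<le> b k k" for k
    unfolding b_def by (rule Banach_limit_ge[OF L s]) (simp add: s_def)
  obtain S where S: "bounded_linear S" "\<And>x y. inner (S x) y = inner x (S y)"
    "\<And>x y. b x y = inner (S x) (S y)"
    and S_comm: "\<forall>V. linear V \<longrightarrow> surj V \<longrightarrow> (\<forall>x y. inner (V x) (V y) = inner x y) \<longrightarrow>
      (\<forall>x y. b (V x) (V y) = b x y) \<longrightarrow> (\<forall>x. V (S x) = S (V x))"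
    by (rule positive_form_factorization[OF b b_sym b_pos]) (rule that)
  have SU: "U (S k) = S (U k)" for k
  proof (rule S_comm[rule_format])
    show "linear U" using U(1) by (simp add: bounded_clinear_def bounded_linear.linear)
    have "s (U k) (U l) = (\<lambda>n. s k l (Suc n))" for k l
      by (rule ext) (simp add: s_def Y(3) funpow_swap1)
    then show "b (U k) (U l) = b k l" for k l
      unfolding b_def by (simp add: Banach_limit_shift[OF L s])
  qed (use U in auto)
  have Si: "\<i> *\<^sub>C S k = S (\<i> *\<^sub>C k)" for k
  proof (rule S_comm[rule_format])
    show "linear ((*\<^sub>C) \<i> :: 'k \<Rightarrow> 'k)" by (rule bounded_linear.linear[OF bounded_linear_scaleC])
    have "k = \<i> *\<^sub>C ((- \<i>) *\<^sub>C k)" for k :: 'k by (simp add: scaleC_scaleC scaleC_one)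
    then show "surj ((*\<^sub>C) \<i> :: 'k \<Rightarrow> 'k)" by (rule surjI[OF sym])
    show "b (\<i> *\<^sub>C k) (\<i> *\<^sub>C l) = b k l" for k l
      by (simp add: b_def s_def[abs_def] YC TnC inner_scaleC_imaginary)
  qed (rule inner_scaleC_imaginary)
  have S_le: "norm (S k) \<le> M * norm (Y k)" for k
  proof (rule power2_le_imp_le)
    show "(norm (S k))\<^sup>2 \<le> (M * norm (Y k))\<^sup>2"
      using b_le[of k k] by (simp add: S(3) power2_norm_eq_inner power_mult_distrib flip: power2_eq_square)
  qed (use M(1) in simp)
  obtain J where J: "bounded_linear J" "\<And>k. J (Y k) = S k" "\<And>x. norm (J x) \<le> M * norm x"
    using bounded_linear_extension_dense[OF Y.linear bounded_linear.linear[OF S(1)] S_le Y(2)] by metis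
  interpret J: bounded_linear J by (rule J(1))
  have JT: "J (T x) = U (J x)" for x
  proof (rule closed_dense_UNIV[OF _ Y(2)])
    show "closed {x. J (T x) = U (J x)}"
      by (intro closed_Collect_eq linear_continuous_on bounded_linear_compose[OF J(1)]
          bounded_linear_compose[OF _ J(1)] T.bounded_linear_axioms)
        (use U(1) in \<open>simp add: bounded_clinear_def\<close>)
    show "J (T x) = U (J x)" if x: "x \<in> range Y" for x
    proof -
      obtain k where "x = Y k" using x by blast
      then show ?thesis by (simp add: J(2) SU flip: Y(3))
    qed
  qed
  have Ji: "J (\<i> *\<^sub>C x) = \<i> *\<^sub>C J x" for x
  proof (rule closed_dense_UNIV[OF _ Y(2)])
    show "closed {x. J (\<i> *\<^sub>C x) = \<i> *\<^sub>C J x}"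
      by (intro closed_Collect_eq linear_continuous_on bounded_linear_compose[OF J(1)]
          bounded_linear_compose[OF bounded_linear_scaleC J(1)] bounded_linear_scaleC)
    show "J (\<i> *\<^sub>C x) = \<i> *\<^sub>C J x" if x: "x \<in> range Y" for x
    proof -
      obtain k where "x = Y k" using x by blast
      then show ?thesis by (simp add: J(2) Si flip: YC)
    qed
  qed
  have approach_Y: "\<exists>n. norm ((T ^^ n) (Y k)) < norm (S k) + e" if e: "0 < e" for k e
  proof (rule ccontr)
    assume "\<not> ?thesis"
    then have "norm (S k) + e \<le> norm ((T ^^ n) (Y k))" for n by (simp add: not_less)
    then have "(norm (S k) + e)\<^sup>2 \<le> s k k n" for n
      using e unfolding s_def power2_norm_eq_inner[symmetric] by (intro power_mono) auto
    then have "(norm (S k) + e)\<^sup>2 \<le> b k k"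
      unfolding b_def by (rule Banach_limit_ge[OF L s])
    also have "\<dots> = (norm (S k))\<^sup>2" by (simp add: S(3) power2_norm_eq_inner)
    finally have "norm (S k) + e \<le> norm (S k)" by (rule power2_le_imp_le) simp
    then show False using e by simp
  qed
  have approach: "\<exists>n. norm ((T ^^ n) x) < norm (J x) + e" if e: "0 < e" for x e
  proof -
    have "0 < e / (3 * (M + 1))" using e M(1) by simp
    then obtain k where k: "dist (Y k) x < e / (3 * (M + 1))"
      using Y(2) closure_approachable[of x "range Y"] by auto
    have "(M + 1) * dist (Y k) x < e / 3" using k M(1) by (simp add: field_simps)
    then have small: "M * norm (Y k - x) < e / 3"
      using norm_ge_zero[of "Y k - x"] unfolding dist_norm distrib_right by linarith
    obtain n where n: "norm ((T ^^ n) (Y k)) < norm (S k) + e / 3" using approach_Y[of "e/3" k] e by auto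
    have "(T ^^ n) x = (T ^^ n) (Y k) - (T ^^ n) (Y k - x)"
      by (simp add: bounded_linear.linear[OF Tn, THEN linear_diff])
    then have "norm ((T ^^ n) x) \<le> norm ((T ^^ n) (Y k)) + M * norm (Y k - x)"
      using norm_triangle_ineq4[of "(T ^^ n) (Y k)" "(T ^^ n) (Y k - x)"] M(2)[of n "Y k - x"] by simp
    moreover have "S k = J x + J (Y k - x)" by (simp add: J.diff J(2))
    then have "norm (S k) \<le> norm (J x) + M * norm (Y k - x)"
      using norm_triangle_ineq[of "J x" "J (Y k - x)"] J(3)[of "Y k - x"] by simp
    ultimately show ?thesis using small n by (intro exI[of _ n]) linarith
  qed
  show ?thesis
    by (rule that[OF bounded_clinearI[OF J(1) Ji] J(3) JT approach S(1,2) J(2)])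
qed

text \<open>
  For \<open>k = J x\<close>, recurrence of the orbit of \<open>k\<close> under \<open>U\<close> is a lower bound for
  \<open>cinner (T\<^sup>n x) (G (J x))\<close> for infinitely many \<open>n\<close>, where \<open>G\<close> is the adjoint of \<open>J\<close>, while
  \<open>norm (T\<^sup>n x)\<close> is eventually almost at most \<open>M * norm (J x)\<close>.  So \<open>G\<close> is bounded below on the
  range of \<open>J\<close>; being onto, it transfers its lower bound to \<open>J\<close>.
\<close>

lemma invertible_asymptote:
  fixes T :: "'h::complex_hilbert_space \<Rightarrow> 'h" and U :: "'k::complex_hilbert_space \<Rightarrow> 'k"
    and J :: "'h \<Rightarrow> 'k"
  assumes K: "0 \<le> K" and M: "0 \<le> M" "\<And>n x. norm ((T ^^ n) x) \<le> M * norm x"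
    and J: "bounded_clinear J" "\<And>x. J (T x) = U (J x)"
    and approach: "\<And>x e. 0 < e \<Longrightarrow> \<exists>n. norm ((T ^^ n) x) < norm (J x) + e"
    and inj: "\<And>x. J x = 0 \<Longrightarrow> x = 0" and dense: "closure (range J) = UNIV"
    and recurrent: "\<And>k c. \<forall>\<^sub>F n in sequentially. cmod (cinner ((U ^^ n) k) k) \<le> c \<Longrightarrow> (norm k)\<^sup>2 \<le> K * c"
  shows "norm x \<le> K * M * norm (J x)" and "surj J"
proof -
  have Jb: "bounded_linear J" using J(1) by (simp add: bounded_clinear_def)
  interpret J: bounded_linear J by (rule Jb)
  obtain G where G: "bounded_linear G" "\<And>x y. inner (J x) y = inner x (G y)"
    using adjoint_exists[OF Jb] by metis
  interpret G: bounded_linear G by (rule G(1))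
  \<comment> \<open>Once the orbit is short, power boundedness keeps it short up to the factor \<open>M\<close>.\<close>
  have decay: "\<forall>\<^sub>F n in sequentially. norm ((T ^^ n) x) \<le> M * (norm (J x) + e)" if e: "0 < e" for x e
  proof -
    obtain n where n: "norm ((T ^^ n) x) < norm (J x) + e" using approach[OF e] by blast
    have "norm ((T ^^ m) x) \<le> M * (norm (J x) + e)" if "m \<ge> n" for m
    proof -
      have "(T ^^ m) x = (T ^^ (m - n)) ((T ^^ n) x)"
        using that by (metis comp_apply funpow_add le_add_diff_inverse2)
      then have "norm ((T ^^ m) x) \<le> M * norm ((T ^^ n) x)" using M(2) by simp
      also have "\<dots> \<le> M * (norm (J x) + e)" using n M(1) by (intro mult_left_mono) auto
      finally show ?thesis .
    qed
    then show ?thesis unfolding eventually_sequentially by blast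
  qed
  \<comment> \<open>Let \<open>e\<close> tend to 0 and cancel one factor \<open>norm (J x)\<close>.\<close>
  have GJ: "norm (J x) \<le> K * M * norm (G (J x))" for x
  proof -
    have "(norm (J x))\<^sup>2 \<le> K * (M * (norm (J x) + e) * norm (G (J x)))" if e: "0 < e" for e
    proof (rule recurrent, rule eventually_mono[OF decay[OF e, of x]])
      fix n assume n: "norm ((T ^^ n) x) \<le> M * (norm (J x) + e)"
      have "cmod (cinner ((U ^^ n) (J x)) (J x)) \<le> norm ((T ^^ n) x) * norm (G (J x))"
        using cmod_cinner_adjoint_le[OF J(1) G(2), of "(T ^^ n) x" "J x"]
        by (simp add: intertwining_funpow[of J T U, OF J(2)])
      also have "\<dots> \<le> M * (norm (J x) + e) * norm (G (J x))"
        using n by (intro mult_right_mono) auto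
      finally show "cmod (cinner ((U ^^ n) (J x)) (J x)) \<le> M * (norm (J x) + e) * norm (G (J x))" .
    qed
    moreover have "((\<lambda>e. K * (M * (norm (J x) + e) * norm (G (J x)))) \<longlongrightarrow>
        K * (M * (norm (J x) + 0) * norm (G (J x)))) (at_right 0)"
      by (intro tendsto_intros)
    ultimately have "(norm (J x))\<^sup>2 \<le> K * (M * (norm (J x) + 0) * norm (G (J x)))"
      by (intro tendsto_lowerbound[where F = "at_right (0::real)"])
        (auto simp: eventually_at_filter)
    then have "norm (J x) * norm (J x) \<le> norm (J x) * (K * M * norm (G (J x)))"
      by (simp add: power2_eq_square mult_ac)
    then show ?thesis
      using K M(1) by (cases "norm (J x) = 0") auto
  qed
  have G_below: "norm u \<le> K * M * norm (G u)" for u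
  proof (rule closed_dense_UNIV[OF _ dense])
    show "closed {u. norm u \<le> K * M * norm (G u)}"
      by (intro closed_Collect_le continuous_intros linear_continuous_on G(1))
  qed (use GJ in blast)
  have adj: "inner (G u) x = inner u (J x)" for u x using G(2) by (metis inner_commute)
  have "surj G"
    by (rule dense_range_bounded_below_surj[OF G(1) G_below])
      (rule dense_range_if_adjoint_injective[OF G(1) adj inj])
  have J_below: "norm x \<le> K * M * norm (J x)" for x
  proof -
    obtain u where u: "x = G u" using \<open>surj G\<close> by blast
    have "norm x * norm x = inner (J x) u"
      by (simp add: G(2) u[symmetric] power2_norm_eq_inner flip: power2_eq_square)
    also have "\<dots> \<le> norm (J x) * norm u" by (rule norm_cauchy_schwarz)
    also have "\<dots> \<le> norm (J x) * (K * M * norm x)"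
      using G_below[of u] u by (intro mult_left_mono) auto
    finally have "norm x * norm x \<le> norm x * (K * M * norm (J x))" by (simp add: mult_ac)
    then show ?thesis using K M(1) by (cases "norm x = 0") auto
  qed
  then show "norm x \<le> K * M * norm (J x)" .
  show "surj J" by (rule dense_range_bounded_below_surj[OF Jb J_below dense])
qed

text \<open>
  The map \<open>X\<close> serves only to show that \<open>J\<close> is injective: \<open>norm (X x) = norm (X (T\<^sup>n x))\<close> for all
  \<open>n\<close>, so no nonzero orbit of \<open>T\<close> can come arbitrarily close to 0.
\<close>

lemma similar_to_unitary_if_recurrent:
  fixes T :: "'h::complex_hilbert_space \<Rightarrow> 'h" and U :: "'k::complex_hilbert_space \<Rightarrow> 'k"
  assumes K: "0 \<le> K" and T: "bounded_clinear T" and M: "0 \<le> M" "\<And>n x. norm ((T ^^ n) x) \<le> M * norm x"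
    and X: "bounded_clinear X" "\<And>x. X x = 0 \<Longrightarrow> x = 0" "\<And>x. X (T x) = U (X x)"
    and Y: "bounded_clinear Y" "\<And>k. Y k = 0 \<Longrightarrow> k = 0" "closure (range Y) = UNIV" "\<And>k. Y (U k) = T (Y k)"
    and U: "bounded_clinear U" "surj U" "\<And>k l. inner (U k) (U l) = inner k l"
    and recurrent: "\<And>k c. \<forall>\<^sub>F n in sequentially. cmod (cinner ((U ^^ n) k) k) \<le> c \<Longrightarrow> (norm k)\<^sup>2 \<le> K * c"
  obtains J where "bounded_clinear J" "bij J" "bounded_clinear (inv J)" "\<And>x. J (T x) = U (J x)"
    "\<And>x. norm x \<le> K * M * norm (J x)" "\<And>x. norm (J x) \<le> M * norm x"
proof -
  obtain J S where J: "bounded_clinear J" "\<And>x. norm (J x) \<le> M * norm x" "\<And>x. J (T x) = U (J x)"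
    "\<And>x e. 0 < e \<Longrightarrow> \<exists>n. norm ((T ^^ n) x) < norm (J x) + e"
    and S: "bounded_linear S" "\<And>k l. inner (S k) l = inner k (S l)" and JY: "\<And>k. J (Y k) = S k"
    by (rule isometric_asymptote[OF T M Y(1,3,4) U]) (rule that)
  interpret X: bounded_linear X using X(1) by (simp add: bounded_clinear_def)
  interpret J: bounded_linear J using J(1) by (simp add: bounded_clinear_def)
  have U_norm: "norm ((U ^^ n) k) = norm k" for n k
    by (induction n) (simp_all add: norm_eq_sqrt_inner U(3))
  have inj: "x = 0" if "J x = 0" for x
  proof -
    obtain B where B: "0 < B" "\<And>x. norm (X x) \<le> norm x * B" using X.pos_bounded by blast
    have "norm (X x) \<le> 0 + e" if e: "0 < e" for e
    proof -
      obtain n where n: "norm ((T ^^ n) x) < e / B" using J(4)[of "e / B" x] \<open>J x = 0\<close> e B(1) by auto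
      have "norm (X x) = norm (X ((T ^^ n) x))"
        by (simp add: intertwining_funpow[of X T U, OF X(3)] U_norm)
      also have "\<dots> \<le> norm ((T ^^ n) x) * B" by (rule B(2))
      also have "\<dots> \<le> e" using n B(1) by (simp add: less_divide_eq)
      finally show ?thesis by simp
    qed
    then have "norm (X x) \<le> 0" by (rule field_le_epsilon)
    then show ?thesis using X(2) by simp
  qed
  \<comment> \<open>The range of \<open>J\<close> contains that of the injective self-adjoint operator \<open>S = J Y\<close>.\<close>
  have "closure (range S) = UNIV"
    by (rule dense_range_if_adjoint_injective[OF S(1,2)]) (metis JY inj Y(2))
  moreover have "range S \<subseteq> range J" using JY by (metis image_subsetI rangeI)
  ultimately have dense: "closure (range J) = UNIV" using closure_mono by blast
  note main = invertible_asymptote[OF K M J(1,3,4) inj dense recurrent]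
  have "inj J" by (rule linear_injective_0[THEN iffD2, OF J.linear]) (use inj in blast)
  then have bij: "bij J" using main(2) by (simp add: bij_def)
  have JJ: "J (inv J y) = y" for y using main(2) by (simp add: surj_f_inv_f)
  have J_eq: "inv J y = x" if "J x = y" for x y using that \<open>inj J\<close> by auto
  have "bounded_linear (inv J)"
  proof (rule bounded_linear_intro)
    show "inv J (y + z) = inv J y + inv J z" for y z by (rule J_eq) (simp add: J.add JJ)
    show "inv J (r *\<^sub>R y) = r *\<^sub>R inv J y" for r y by (rule J_eq) (simp add: J.scaleR JJ)
    show "norm (inv J y) \<le> norm y * (K * M)" for y
      using main(1)[of "inv J y"] by (simp add: JJ mult.commute)
  qed
  moreover have "inv J (\<i> *\<^sub>C y) = \<i> *\<^sub>C inv J y" for y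
    using J(1) by (intro J_eq) (simp add: JJ bounded_clinear_def)
  ultimately have "bounded_clinear (inv J)" by (rule bounded_clinearI)
  then show ?thesis by (rule that[OF J(1) bij _ J(3) main(1) J(2)])
qed

section \<open>Powers of a unitary operator as spectral integrals\<close>

lemma space_circle_borel: "space circle_borel = unit_circle"
  by (simp add: circle_borel_def space_restrict_space)

lemma sets_circle_borel_iff: "A \<in> sets circle_borel \<longleftrightarrow> A \<in> sets borel \<and> A \<subseteq> unit_circle"
  unfolding circle_borel_def by (subst sets_restrict_space_iff) auto

lemma unit_circle_in_sets: "unit_circle \<in> sets circle_borel"
  by (simp add: sets_circle_borel_iff)

context
  fixes P :: "complex set \<Rightarrow> 'a::complex_hilbert_space \<Rightarrow> 'a"
  assumes pvm: "projection_valued_measure P"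
begin

lemma pvm_linear: "A \<in> sets circle_borel \<Longrightarrow> bounded_clinear (P A)"
  using pvm by (simp add: projection_valued_measure_def orthogonal_projection_def)

lemma pvm_Int: "A \<in> sets circle_borel \<Longrightarrow> B \<in> sets circle_borel \<Longrightarrow> P A (P B x) = P (A \<inter> B) x"
  using pvm by (simp add: projection_valued_measure_def)

lemma pvm_empty: "P {} x = 0"
  using pvm by (simp add: projection_valued_measure_def)

lemma pvm_unit_circle: "P unit_circle x = x"
  using pvm by (simp add: projection_valued_measure_def)

lemma cinner_pvm:
  assumes A: "A \<in> sets circle_borel"
  shows "cinner (P A x) x = complex_of_real ((norm (P A x))\<^sup>2)"
proof -
  have "is_adjoint (P A) (P A)"
    using pvm A by (simp add: projection_valued_measure_def orthogonal_projection_def)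
  then have "cinner (P A (P A x)) x = cinner (P A x) (P A x)" by (simp add: is_adjoint_def)
  then show ?thesis using pvm_Int[OF A A] by (simp add: cinner_self)
qed

lemma pvm_sums:
  assumes "range A \<subseteq> sets circle_borel" "disjoint_family A"
  shows "(\<lambda>i::nat. P (A i) x) sums P (\<Union>i. A i) x"
  using pvm assms by (simp add: projection_valued_measure_def)

lemma pvm_Un:
  assumes A: "A \<in> sets circle_borel" "B \<in> sets circle_borel" and disj: "A \<inter> B = {}"
  shows "P (A \<union> B) x = P A x + P B x"
proof -
  have "range (binaryset A B) \<subseteq> sets circle_borel" using A by (auto simp: range_binaryset_eq)
  moreover have "disjoint_family (binaryset A B)"
    using disj by (auto simp: disjoint_family_on_def binaryset_def)
  ultimately have "(\<lambda>i. P (binaryset A B i) x) sums P (A \<union> B) x"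
    using pvm_sums[of "binaryset A B" x] by (simp add: UN_binaryset_eq)
  moreover have "(\<lambda>i. P (binaryset A B i) x) sums (\<Sum>i\<in>{0, 1}. P (binaryset A B i) x)"
    by (rule sums_finite) (auto simp: binaryset_def pvm_empty)
  ultimately show ?thesis by (simp add: sums_unique2 binaryset_def)
qed

lemma pvm_UN:
  assumes "finite I" "\<And>i. i \<in> I \<Longrightarrow> A i \<in> sets circle_borel" "disjoint_family_on A I"
  shows "P (\<Union>i\<in>I. A i) x = (\<Sum>i\<in>I. P (A i) x)"
  using assms
proof (induction I)
  case (insert i I)
  have "P (A i \<union> (\<Union>j\<in>I. A j)) x = P (A i) x + P (\<Union>j\<in>I. A j) x"
    using insert.hyps insert.prems
    by (intro pvm_Un sets.finite_UN) (auto simp: disjoint_family_on_def)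
  moreover have "P (\<Union>j\<in>I. A j) x = (\<Sum>j\<in>I. P (A j) x)"
    using insert.prems by (intro insert.IH) (auto simp: disjoint_family_on_def)
  ultimately show ?case using insert.hyps by simp
qed (simp add: pvm_empty)

lemma sets_pvm_diag: "sets (pvm_diag P x) = sets circle_borel"
  and space_pvm_diag: "space (pvm_diag P x) = unit_circle"
proof -
  have "sigma_algebra unit_circle (sets circle_borel)"
    using sets.sigma_algebra_axioms[of circle_borel] by (simp add: space_circle_borel)
  then show "sets (pvm_diag P x) = sets circle_borel"
    unfolding pvm_diag_def by (rule sigma_algebra.sets_measure_of_eq)
  show "space (pvm_diag P x) = unit_circle"
    unfolding pvm_diag_def using sets.space_closed[of circle_borel]
    by (simp add: space_measure_of space_circle_borel)
qed

text \<open>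
  The number \<open>cinner (P A x) x\<close> equals \<open>(norm (P A x))\<^sup>2\<close>, and strong countable additivity of \<open>P\<close>
  gives countable additivity of the set function.
\<close>

lemma emeasure_pvm_diag:
  assumes A: "A \<in> sets circle_borel"
  shows "emeasure (pvm_diag P x) A = ennreal ((norm (P A x))\<^sup>2)"
proof -
  have Re: "Re (cinner (P B x) x) = (norm (P B x))\<^sup>2" if "B \<in> sets circle_borel" for B
    by (simp add: cinner_pvm[OF that])
  have "emeasure (pvm_diag P x) A = ennreal (Re (cinner (P A x) x))"
  proof (rule emeasure_measure_of[OF pvm_diag_def])
    show "sets circle_borel \<subseteq> Pow unit_circle"
      using sets.space_closed[of circle_borel] by (simp add: space_circle_borel)
    show "positive (sets (pvm_diag P x)) (\<lambda>A. ennreal (Re (cinner (P A x) x)))"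
      by (simp add: positive_def pvm_empty cinner_zero_left)
    show "countably_additive (sets (pvm_diag P x)) (\<lambda>A. ennreal (Re (cinner (P A x) x)))"
      unfolding sets_pvm_diag countably_additive_def
    proof (intro allI impI)
      fix B :: "nat \<Rightarrow> complex set"
      assume B: "range B \<subseteq> sets circle_borel" "disjoint_family B" "\<Union> (range B) \<in> sets circle_borel"
      have "(\<lambda>i. inner (P (B i) x) x) sums inner (P (\<Union>i. B i) x) x"
        by (rule bounded_linear.sums[OF bounded_linear_inner_left pvm_sums[OF B(1,2)]])
      then have "(\<lambda>i. Re (cinner (P (B i) x) x)) sums Re (cinner (P (\<Union>i. B i) x) x)"
        by (simp add: inner_eq_Re_cinner)
      then have "(\<lambda>i. ennreal (Re (cinner (P (B i) x) x))) sums ennreal (Re (cinner (P (\<Union>i. B i) x) x))"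
        using B by (subst sums_ennreal) (auto simp: Re)
      then show "(\<Sum>i. ennreal (Re (cinner (P (B i) x) x))) = ennreal (Re (cinner (P (\<Union>i. B i) x) x))"
        by (rule sums_unique[symmetric])
    qed
    show "A \<in> sets (pvm_diag P x)" using A by (simp add: sets_pvm_diag)
  qed
  then show ?thesis by (simp add: Re[OF A])
qed

lemma finite_circle_measure_pvm_diag: "finite_circle_measure (pvm_diag P x)"
  unfolding finite_circle_measure_def
  by (intro conjI sets_pvm_diag finite_measureI)
    (simp add: space_pvm_diag emeasure_pvm_diag[OF unit_circle_in_sets])

lemma measure_pvm_diag:
  "A \<in> sets circle_borel \<Longrightarrow> measure (pvm_diag P x) A = (norm (P A x))\<^sup>2"
  by (simp add: measure_def emeasure_pvm_diag)

end

text \<open>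
  Rounding to the grid of mesh \<open>1 / Suc m\<close>: on the circle it takes finitely many values and
  approximates the identity uniformly, so it turns spectral integrals into finite sums.
\<close>

definition grid_step :: "nat \<Rightarrow> complex \<Rightarrow> complex" where
  "grid_step m z = Complex (of_int \<lfloor>real (Suc m) * Re z\<rfloor> / real (Suc m)) (of_int \<lfloor>real (Suc m) * Im z\<rfloor> / real (Suc m))"

lemma grid_step_near: "cmod (z - grid_step m z) \<le> 2 / real (Suc m)"
proof -
  have near: "\<bar>t - of_int \<lfloor>real (Suc m) * t\<rfloor> / real (Suc m)\<bar> \<le> 1 / real (Suc m)" for t :: real
  proof -
    have "t - of_int \<lfloor>real (Suc m) * t\<rfloor> / real (Suc m) = frac (real (Suc m) * t) / real (Suc m)"
      by (simp add: frac_def diff_divide_distrib del: of_nat_Suc)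
    then show ?thesis
      using frac_lt_1[of "real (Suc m) * t"] frac_ge_0[of "real (Suc m) * t"]
      by (simp add: divide_right_mono del: of_nat_Suc)
  qed
  have "cmod (z - grid_step m z) \<le> \<bar>Re (z - grid_step m z)\<bar> + \<bar>Im (z - grid_step m z)\<bar>"
    by (rule cmod_le)
  also have "\<dots> \<le> 1 / real (Suc m) + 1 / real (Suc m)"
    unfolding grid_step_def by (intro add_mono) (use near in \<open>simp_all del: of_nat_Suc\<close>)
  finally show ?thesis by simp
qed

lemma finite_grid_step: "finite (grid_step m ` unit_circle)"
proof (rule finite_subset)
  let ?I = "{- int (Suc m)..int (Suc m)}"
  show "grid_step m ` unit_circle
      \<subseteq> (\<lambda>(a, b). Complex (of_int a / real (Suc m)) (of_int b / real (Suc m))) ` (?I \<times> ?I)"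
  proof
    fix w assume "w \<in> grid_step m ` unit_circle"
    then obtain z where z: "cmod z = 1" "w = grid_step m z" by auto
    have "\<lfloor>real (Suc m) * t\<rfloor> \<in> ?I" if "\<bar>t\<bar> \<le> 1" for t
    proof -
      have "\<bar>real (Suc m) * t\<bar> \<le> real (Suc m) * 1"
        unfolding abs_mult by (intro mult_mono) (use that in auto)
      then have le: "- real (Suc m) \<le> real (Suc m) * t" "real (Suc m) * t \<le> real (Suc m)"
        using abs_le_D1 abs_le_D2 by (fastforce simp del: of_nat_Suc)+
      have "- int (Suc m) \<le> \<lfloor>real (Suc m) * t\<rfloor>"
        unfolding le_floor_iff using le(1) by simp
      moreover have "\<lfloor>real (Suc m) * t\<rfloor> \<le> int (Suc m)"
        using floor_mono[OF le(2)] by simp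
      ultimately show ?thesis by simp
    qed
    from this[of "Re z"] this[of "Im z"] show
      "w \<in> (\<lambda>(a, b). Complex (of_int a / real (Suc m)) (of_int b / real (Suc m))) ` (?I \<times> ?I)"
      using abs_Re_le_cmod[of z] abs_Im_le_cmod[of z] z unfolding grid_step_def by force
  qed
qed simp

lemma grid_step_measurable [measurable]: "grid_step m \<in> borel_measurable borel"
proof -
  have "grid_step m = (\<lambda>z. complex_of_real (of_int \<lfloor>real (Suc m) * Re z\<rfloor> / real (Suc m))
      + \<i> * complex_of_real (of_int \<lfloor>real (Suc m) * Im z\<rfloor> / real (Suc m)))"
    by (rule ext) (simp add: grid_step_def complex_eq_iff)
  also have "\<dots> \<in> borel_measurable borel" by measurable
  finally show ?thesis .
qed

lemma grid_step_LIMSEQ: "(\<lambda>m. grid_step m z) \<longlonglongrightarrow> z"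
proof (rule Lim_null[THEN iffD2], rule Lim_null_comparison)
  show "\<forall>\<^sub>F m in sequentially. norm (grid_step m z - z) \<le> 2 * inverse (real (Suc m))"
    using grid_step_near[of z] by (simp add: norm_minus_commute divide_inverse del: of_nat_Suc)
  show "(\<lambda>m. 2 * inverse (real (Suc m))) \<longlonglongrightarrow> 0"
    by (rule tendsto_mult_right_zero[OF LIMSEQ_inverse_real_of_nat])
qed

definition cell :: "nat \<Rightarrow> complex \<Rightarrow> complex set" where
  "cell m z = {\<zeta> \<in> unit_circle. grid_step m \<zeta> = z}"

lemma cell_in_sets: "cell m z \<in> sets circle_borel"
proof -
  have "cell m z = (grid_step m -` {z} \<inter> space borel) \<inter> unit_circle" by (auto simp: cell_def)
  moreover have "grid_step m -` {z} \<inter> space borel \<in> sets borel" by measurable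
  ultimately have "cell m z \<in> sets borel" by simp
  then show ?thesis by (auto simp: sets_circle_borel_iff cell_def)
qed

text \<open>
  The integral of the \<open>n\<close>-th power of \<open>grid_step m\<close> with respect to \<open>P\<close>.
\<close>

definition step_power ::
    "(complex set \<Rightarrow> 'a::complex_hilbert_space \<Rightarrow> 'a) \<Rightarrow> nat \<Rightarrow> nat \<Rightarrow> 'a \<Rightarrow> 'a" where
  "step_power P m n x = (\<Sum>z\<in>grid_step m ` unit_circle. z ^ n *\<^sub>C P (cell m z) x)"

context
  fixes P :: "complex set \<Rightarrow> 'a::complex_hilbert_space \<Rightarrow> 'a"
  assumes pvm: "projection_valued_measure P"
begin

lemma bounded_clinear_step_power: "bounded_clinear (step_power P m n)"
proof (rule bounded_clinearI)
  have P: "bounded_linear (P (cell m z))" "P (cell m z) (c *\<^sub>C x) = c *\<^sub>C P (cell m z) x" for z c x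
    using pvm_linear[OF pvm cell_in_sets] by (auto simp: bounded_clinear_def)
  show "bounded_linear (step_power P m n)"
    unfolding step_power_def
    by (intro bounded_linear_sum bounded_linear_compose[OF bounded_linear_scaleC P(1)])
  show "step_power P m n (\<i> *\<^sub>C x) = \<i> *\<^sub>C step_power P m n x" for x
    by (simp add: step_power_def P(2) scaleC_sum_right scaleC_scaleC mult.commute)
qed

lemma step_power_0: "step_power P m 0 x = x"
proof -
  have "(\<Union>z\<in>grid_step m ` unit_circle. cell m z) = unit_circle" by (auto simp: cell_def)
  moreover have "disjoint_family_on (cell m) (grid_step m ` unit_circle)"
    by (auto simp: disjoint_family_on_def cell_def)
  ultimately have "P unit_circle x = (\<Sum>z\<in>grid_step m ` unit_circle. P (cell m z) x)"
    using pvm_UN[OF pvm finite_grid_step[of m], of "cell m" x] cell_in_sets by simp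
  then show ?thesis by (simp add: step_power_def scaleC_one pvm_unit_circle[OF pvm])
qed

text \<open>
  The projections of distinct cells annihilate each other, so the spectral integral of a step
  function is multiplicative.
\<close>

lemma step_power_Suc: "step_power P m (Suc n) x = step_power P m (Suc 0) (step_power P m n x)"
proof -
  let ?Z = "grid_step m ` unit_circle"
  have "P (cell m z) (step_power P m n x) = z ^ n *\<^sub>C P (cell m z) x" if z: "z \<in> ?Z" for z
  proof -
    have lin: "linear (P (cell m z))" and C: "P (cell m z) (c *\<^sub>C y) = c *\<^sub>C P (cell m z) y" for c y
      using pvm_linear[OF pvm cell_in_sets, of m z] by (auto simp: bounded_clinear_def bounded_linear.linear)
    have "P (cell m z) (step_power P m n x) = (\<Sum>w\<in>?Z. w ^ n *\<^sub>C P (cell m z \<inter> cell m w) x)"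
      by (simp add: step_power_def linear_sum[OF lin] C pvm_Int[OF pvm] cell_in_sets)
    also have "\<dots> = (\<Sum>w\<in>?Z. if w = z then z ^ n *\<^sub>C P (cell m z) x else 0)"
    proof (rule sum.cong[OF refl])
      fix w
      have "cell m z \<inter> cell m w = {}" if "w \<noteq> z" using that by (auto simp: cell_def)
      then show "w ^ n *\<^sub>C P (cell m z \<inter> cell m w) x = (if w = z then z ^ n *\<^sub>C P (cell m z) x else 0)"
        by (simp add: pvm_empty[OF pvm] scaleC_zero)
    qed
    also have "\<dots> = z ^ n *\<^sub>C P (cell m z) x" using z finite_grid_step by simp
    finally show ?thesis .
  qed
  then show ?thesis
    by (simp add: step_power_def[of P m "Suc n"] step_power_def[of P m "Suc 0" "step_power P m n x"] scaleC_scaleC)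
qed

lemma measurable_pvm_diag: "f \<in> borel_measurable borel \<Longrightarrow> f \<in> borel_measurable (pvm_diag P x)"
  unfolding measurable_cong_sets[OF sets_pvm_diag[OF pvm] refl] circle_borel_def
  by (rule measurable_restrict_space1)

lemma integrable_pvm_diag:
  assumes "f \<in> borel_measurable borel" and "\<And>z. z \<in> unit_circle \<Longrightarrow> cmod (f z) \<le> B"
  shows "integrable (pvm_diag P x) (f :: complex \<Rightarrow> complex)"
proof -
  interpret finite_measure "pvm_diag P x"
    using finite_circle_measure_pvm_diag[OF pvm] by (simp add: finite_circle_measure_def)
  show ?thesis
  proof (rule integrable_const_bound[of _ B])
    show "AE z in pvm_diag P x. norm (f z) \<le> B"
      using assms(2) by (intro AE_I2) (simp add: space_pvm_diag[OF pvm])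
    show "f \<in> borel_measurable (pvm_diag P x)"
      by (rule measurable_pvm_diag) (rule assms)
  qed
qed

lemma grid_step_le: "z \<in> unit_circle \<Longrightarrow> cmod (grid_step m z) \<le> 3"
proof -
  assume "z \<in> unit_circle"
  have "cmod (grid_step m z) \<le> cmod z + cmod (z - grid_step m z)"
    using norm_triangle_ineq4[of z "z - grid_step m z"] by simp
  moreover have "2 / real (Suc m) \<le> 2" by (simp add: divide_le_eq)
  ultimately show ?thesis using grid_step_near[of z m] \<open>z \<in> unit_circle\<close> by simp
qed

lemma cinner_step_power: "cinner (step_power P m n x) x = (LINT z|pvm_diag P x. grid_step m z ^ n)"
proof -
  let ?Z = "grid_step m ` unit_circle"
  interpret finite_measure "pvm_diag P x"
    using finite_circle_measure_pvm_diag[OF pvm] by (simp add: finite_circle_measure_def)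
  have cell: "cell m w \<in> sets (pvm_diag P x)" for w by (simp add: sets_pvm_diag[OF pvm] cell_in_sets)
  have int: "integrable (pvm_diag P x) (\<lambda>z. indicat_real (cell m w) z *\<^sub>R (w ^ n))" for w
    by (intro integrable_scaleR_left integrable_real_indicator cell) (simp add: emeasure_eq_measure)
  have "(LINT z|pvm_diag P x. grid_step m z ^ n)
      = (LINT z|pvm_diag P x. (\<Sum>w\<in>?Z. indicat_real (cell m w) z *\<^sub>R (w ^ n)))"
  proof (rule Bochner_Integration.integral_cong[OF refl])
    fix z assume "z \<in> space (pvm_diag P x)"
    then have z: "z \<in> unit_circle" by (simp add: space_pvm_diag[OF pvm])
    have "(\<Sum>w\<in>?Z. indicat_real (cell m w) z *\<^sub>R (w ^ n))
        = (\<Sum>w\<in>?Z. if w = grid_step m z then w ^ n else 0)"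
      using z by (intro sum.cong refl) (auto simp: cell_def)
    also have "\<dots> = grid_step m z ^ n" using z finite_grid_step[of m] by simp
    finally show "grid_step m z ^ n = (\<Sum>w\<in>?Z. indicat_real (cell m w) z *\<^sub>R (w ^ n))" ..
  qed
  also have "\<dots> = (\<Sum>w\<in>?Z. (LINT z|pvm_diag P x. indicat_real (cell m w) z *\<^sub>R (w ^ n)))"
    by (rule Bochner_Integration.integral_sum) (rule int)
  also have "\<dots> = (\<Sum>w\<in>?Z. measure (pvm_diag P x) (cell m w) *\<^sub>R (w ^ n))"
    by (intro sum.cong refl, subst integral_scaleR_left)
      (auto intro!: integrable_real_indicator cell simp: emeasure_eq_measure
        sets.Int_space_eq2[OF cell])
  also have "\<dots> = cinner (step_power P m n x) x"
    by (simp add: step_power_def cinner_sum_left cinner_scaleC_left cinner_pvm[OF pvm cell_in_sets]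
        measure_pvm_diag[OF pvm cell_in_sets] scaleR_conv_of_real mult.commute)
  finally show ?thesis ..
qed

text \<open>
  The spectral representation of \<open>U\<close> is given by its quadratic form.  The numerical radius turns
  the uniform approximation of \<open>\<zeta>\<close> by step functions into an approximation of \<open>U\<close> in norm.
\<close>

lemma step_power_near:
  assumes U: "bounded_clinear U" and spectral: "\<And>x. cinner (U x) x = (LINT z|pvm_diag P x. z)"
  shows "norm (U x - step_power P m (Suc 0) x) \<le> 4 * inverse (real (Suc m)) * norm x"
proof -
  have D: "bounded_clinear (\<lambda>x. U x - step_power P m (Suc 0) x)"
    using U bounded_clinear_step_power[of m "Suc 0"]
    by (auto simp: bounded_clinear_def scaleC_diff_right intro: bounded_linear_sub)
  have "cmod (cinner (U x - step_power P m (Suc 0) x) x) \<le> 2 / real (Suc m) * (norm x)\<^sup>2" for x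
  proof -
    interpret finite_measure "pvm_diag P x"
      using finite_circle_measure_pvm_diag[OF pvm] by (simp add: finite_circle_measure_def)
    have int: "integrable (pvm_diag P x) (\<lambda>z. z)" "integrable (pvm_diag P x) (grid_step m)"
      by (rule integrable_pvm_diag[of _ 1]; simp) (rule integrable_pvm_diag[of _ 3]; simp add: grid_step_le)
    have "cinner (U x - step_power P m (Suc 0) x) x = (LINT z|pvm_diag P x. z - grid_step m z)"
      using int by (simp add: cinner_diff_left spectral cinner_step_power)
    also have "cmod \<dots> \<le> (LINT z|pvm_diag P x. cmod (z - grid_step m z))"
      by (rule integral_norm_bound)
    also have "\<dots> \<le> (LINT z|pvm_diag P x. 2 / real (Suc m))"
      using int by (intro integral_mono grid_step_near) auto
    also have "\<dots> = 2 / real (Suc m) * (norm x)\<^sup>2"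
      by (simp add: measure_pvm_diag[OF pvm unit_circle_in_sets] space_pvm_diag[OF pvm] pvm_unit_circle[OF pvm])
    finally show ?thesis .
  qed
  from norm_le_numerical_radius[OF D this, of x] show ?thesis
    by (simp add: divide_inverse)
qed

lemma step_power_LIMSEQ:
  assumes U: "bounded_clinear U" and spectral: "\<And>x. cinner (U x) x = (LINT z|pvm_diag P x. z)"
  shows "(\<lambda>m. step_power P m n x) \<longlonglongrightarrow> (U ^^ n) x"
proof (induction n)
  case 0
  show ?case by (simp add: step_power_0)
next
  case (Suc n)
  have U': "bounded_linear U" using U by (simp add: bounded_clinear_def)
  have "(\<lambda>m. U (step_power P m n x) - step_power P m (Suc 0) (step_power P m n x)) \<longlonglongrightarrow> 0"
  proof (rule Lim_null_comparison)
    show "\<forall>\<^sub>F m in sequentially. norm (U (step_power P m n x) - step_power P m (Suc 0) (step_power P m n x))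
        \<le> 4 * inverse (real (Suc m)) * norm (step_power P m n x)"
      using step_power_near[OF U spectral] by simp
    have "(\<lambda>m. 4 * inverse (real (Suc m)) * norm (step_power P m n x)) \<longlonglongrightarrow> 4 * 0 * norm ((U ^^ n) x)"
      by (intro tendsto_mult tendsto_const LIMSEQ_inverse_real_of_nat tendsto_norm Suc)
    then show "(\<lambda>m. 4 * inverse (real (Suc m)) * norm (step_power P m n x)) \<longlonglongrightarrow> 0" by simp
  qed
  from tendsto_diff[OF bounded_linear.tendsto[OF U' Suc] this] show ?case
    by (simp flip: step_power_Suc)
qed

text \<open>
  The representation of \<open>U\<close> passes to its powers because both sides are limits of the
  corresponding terms for step functions, on which the integral is multiplicative.
\<close>

lemma cinner_funpow_eq_integral:
  assumes U: "bounded_clinear U" and spectral: "\<And>x. cinner (U x) x = (LINT z|pvm_diag P x. z)"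
  shows "cinner ((U ^^ n) x) x = (LINT z|pvm_diag P x. z ^ n)"
proof (rule LIMSEQ_unique)
  interpret finite_measure "pvm_diag P x"
    using finite_circle_measure_pvm_diag[OF pvm] by (simp add: finite_circle_measure_def)
  show "(\<lambda>m. cinner (step_power P m n x) x) \<longlonglongrightarrow> cinner ((U ^^ n) x) x"
    by (rule tendsto_cinner_left[OF step_power_LIMSEQ[OF U spectral]])
  have "(\<lambda>m. LINT z|pvm_diag P x. grid_step m z ^ n) \<longlonglongrightarrow> (LINT z|pvm_diag P x. z ^ n)"
  proof (rule integral_dominated_convergence[where w = "\<lambda>_. 3 ^ n"])
    show "(\<lambda>z. z ^ n) \<in> borel_measurable (pvm_diag P x)" "(\<lambda>z. grid_step m z ^ n) \<in> borel_measurable (pvm_diag P x)" for m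
      by (rule measurable_pvm_diag; measurable)+
    show "AE z in pvm_diag P x. (\<lambda>m. grid_step m z ^ n) \<longlonglongrightarrow> z ^ n"
      by (intro AE_I2 tendsto_power grid_step_LIMSEQ)
    show "AE z in pvm_diag P x. norm (grid_step m z ^ n) \<le> 3 ^ n" for m
      by (intro AE_I2) (simp add: space_pvm_diag[OF pvm] norm_power power_mono grid_step_le)
  qed simp
  then show "(\<lambda>m. cinner (step_power P m n x) x) \<longlonglongrightarrow> (LINT z|pvm_diag P x. z ^ n)"
    by (simp add: cinner_step_power)
qed

end

section \<open>Recurrence of unitary orbits\<close>

lemma cmod_fourier_coeff_pvm_diag:
  assumes P: "is_spectral_measure U P" and U: "bounded_clinear U"
  shows "cmod (fourier_coeff (pvm_diag P x) (int n)) = cmod (cinner ((U ^^ n) x) x)"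
proof -
  have pvm: "projection_valued_measure P" and spectral: "\<And>x. cinner (U x) x = (LINT z|pvm_diag P x. z)"
    using P by (auto simp: is_spectral_measure_def)
  have "fourier_coeff (pvm_diag P x) (int n) = (LINT z|pvm_diag P x. cnj (z ^ n))"
    unfolding fourier_coeff_def
  proof (rule Bochner_Integration.integral_cong[OF refl])
    fix z assume "z \<in> space (pvm_diag P x)"
    then have "cmod z = 1" by (simp add: space_pvm_diag[OF pvm])
    then have "z * cnj z = 1" by (metis complex_norm_square of_real_1 one_power2)
    \<comment> \<open>On the unit circle inversion is conjugation, so the coefficient is a conjugated moment.\<close>
    then have "inverse z = cnj z" by (rule inverse_unique)
    then show "z powi - int n = cnj (z ^ n)" by (simp add: power_int_minus flip: power_inverse)
  qed
  also have "\<dots> = cnj (cinner ((U ^^ n) x) x)"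
    by (simp add: cinner_funpow_eq_integral[OF pvm U spectral] del: complex_cnj_power)
  finally show ?thesis by simp
qed

lemma pvm_diag_concentrated:
  assumes nu: "finite_circle_measure \<nu>" and P: "projection_valued_measure P"
    and null: "\<forall>A \<in> sets circle_borel. emeasure \<nu> A = 0 \<longleftrightarrow> P A = (\<lambda>x. 0)"
    and E: "E \<in> sets circle_borel" "measure \<nu> E = measure \<nu> unit_circle"
  shows "measure (pvm_diag P x) E = (norm x)\<^sup>2"
proof -
  interpret finite_measure \<nu> using nu by (simp add: finite_circle_measure_def)
  have sets: "sets \<nu> = sets circle_borel" using nu by (simp add: finite_circle_measure_def)
  have sub: "E \<subseteq> unit_circle" using E(1) by (simp add: sets_circle_borel_iff)
  have "measure \<nu> (unit_circle - E) = 0"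
    using E sub by (simp add: finite_measure_Diff sets unit_circle_in_sets)
  then have "emeasure \<nu> (unit_circle - E) = 0" by (simp add: emeasure_eq_measure)
  then have "P (unit_circle - E) x = 0"
    using null E(1) unit_circle_in_sets by (simp add: sets.Diff)
  moreover have "P (E \<union> (unit_circle - E)) x = P E x + P (unit_circle - E) x"
    using E(1) unit_circle_in_sets by (intro pvm_Un[OF P]) auto
  moreover have "E \<union> (unit_circle - E) = unit_circle" using sub by blast
  ultimately have "P E x = x" by (simp add: pvm_unit_circle[OF P])
  then show ?thesis by (simp add: measure_pvm_diag[OF P E(1)])
qed

text \<open>
  The hypothesis on \<open>E\<close>, applied to the diagonal spectral measure of \<open>k\<close>.
\<close>

lemma recurrence_of_unitary:
  assumes K: "0 \<le> K" and E: "E \<in> sets circle_borel"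
    and hyp: "\<And>\<mu>. finite_circle_measure \<mu> \<Longrightarrow> measure \<mu> E = measure \<mu> unit_circle \<Longrightarrow>
      ereal (measure \<mu> E) \<le> ereal K * limsup (\<lambda>n. ereal (cmod (fourier_coeff \<mu> (int n))))"
    and U: "bounded_clinear U" and nu: "scalar_spectral_measure U \<nu>" "measure \<nu> E = measure \<nu> unit_circle"
    and c: "\<forall>\<^sub>F n in sequentially. cmod (cinner ((U ^^ n) k) k) \<le> c"
  shows "(norm k)\<^sup>2 \<le> K * c"
proof -
  obtain P where P: "is_spectral_measure U P"
    and null: "\<forall>A \<in> sets circle_borel. emeasure \<nu> A = 0 \<longleftrightarrow> P A = (\<lambda>x. 0)"
    using nu(1) unfolding scalar_spectral_measure_def by blast
  have pvm: "projection_valued_measure P" using P by (simp add: is_spectral_measure_def)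
  have "finite_circle_measure \<nu>" using nu(1) by (simp add: scalar_spectral_measure_def)
  note E_measure = pvm_diag_concentrated[OF this pvm null E nu(2), of k]
  have "ereal ((norm k)\<^sup>2) \<le> ereal K * limsup (\<lambda>n. ereal (cmod (fourier_coeff (pvm_diag P k) (int n))))"
    using hyp[OF finite_circle_measure_pvm_diag[OF pvm], of k] E_measure
    by (simp add: measure_pvm_diag[OF pvm unit_circle_in_sets] pvm_unit_circle[OF pvm])
  also have "limsup (\<lambda>n. ereal (cmod (fourier_coeff (pvm_diag P k) (int n)))) \<le> ereal c"
    using c by (intro Limsup_bounded) (simp add: cmod_fourier_coeff_pvm_diag[OF P U])
  then have "ereal K * limsup (\<lambda>n. ereal (cmod (fourier_coeff (pvm_diag P k) (int n)))) \<le> ereal K * ereal c"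
    by (rule ereal_mult_left_mono) (use K in simp)
  finally show ?thesis by simp
qed

section \<open>Similarity to the unitary operator\<close>

lemma unitary_opE:
  assumes "unitary_op U"
  obtains V where "bounded_clinear U" "bounded_clinear V" "\<And>x. V (U x) = x" "\<And>x. U (V x) = x"
    "\<And>x y. inner (U x) (U y) = inner x y"
proof -
  obtain V where V: "bounded_clinear V" "is_adjoint U V" "V \<circ> U = id" "U \<circ> V = id"
    using assms unfolding unitary_op_def by blast
  have VU: "V (U x) = x" and UV: "U (V x) = x" for x
    using fun_cong[OF V(3), of x] fun_cong[OF V(4), of x] by simp_all
  have "inner (U x) (U y) = inner x y" for x y
    using V(2) by (simp add: inner_eq_Re_cinner is_adjoint_def VU)
  moreover have "bounded_clinear U" using assms by (simp add: unitary_op_def)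
  ultimately show ?thesis using that V(1) VU UV by blast
qed

lemma bounded_clinear_compose:
  assumes "bounded_clinear f" "bounded_clinear g"
  shows "bounded_clinear (\<lambda>x. f (g x))"
  using assms by (auto simp: bounded_clinear_def intro: bounded_linear_compose)

theorem theorem2p12:
  fixes K :: real
    and E :: "complex set"
    and U :: "'k::complex_hilbert_space \<Rightarrow> 'k"
    and \<nu> :: "complex measure"
    and T :: "'h::complex_hilbert_space \<Rightarrow> 'h"
  assumes "separable_space (euclidean :: 'h topology)"
    and "separable_space (euclidean :: 'k topology)"
    and "K > 0"
    and "E \<in> sets circle_borel"
    and "\<And>\<mu>. finite_circle_measure \<mu> \<Longrightarrow> measure \<mu> E = measure \<mu> unit_circle \<Longrightarrow>
      ereal (measure \<mu> E) \<le> ereal K * limsup (\<lambda>n. ereal (cmod (fourier_coeff \<mu> (int n))))"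
    and "unitary_op U"
    and "scalar_spectral_measure U \<nu>"
    and "measure \<nu> E = measure \<nu> unit_circle"
    and "bounded_clinear T"
    and "power_bounded T"
    and "T \<sim>\<^sub>o U"
  shows "T \<approx>\<^sub>o U \<and> invertible_op T \<and>
    (SUP n\<in>{..0::int}. ereal (onorm (op_powi T n))) \<le>
      ereal (K ^ 3) * (SUP n::nat. ereal (onorm (T ^^ n))) ^ 8"
proof -
  note T = \<open>bounded_clinear T\<close>
  have K: "0 \<le> K" using \<open>K > 0\<close> by simp
  obtain V where U: "bounded_clinear U" and V: "bounded_clinear V" "\<And>x. V (U x) = x" "\<And>x. U (V x) = x"
    and U_inner: "\<And>x y. inner (U x) (U y) = inner x y"
    by (rule unitary_opE[OF \<open>unitary_op U\<close>]) (rule that)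
  have surj_U: "surj U" by (rule surjI[of U V]) (rule V(3))
  have recurrent: "(norm k)\<^sup>2 \<le> K * c"
    if "\<forall>\<^sub>F n in sequentially. cmod (cinner ((U ^^ n) k) k) \<le> c" for k c
    by (rule recurrence_of_unitary[OF K assms(4) _ U assms(7,8) that]) (rule assms(5))
  define M where "M = (SUP n. onorm (T ^^ n))"
  have bdd: "bdd_above (range (\<lambda>n. onorm (T ^^ n)))"
    using \<open>power_bounded T\<close> by (simp add: power_bounded_def)
  have Tn: "bounded_linear (T ^^ n)" for n
    using bounded_clinear_funpow[OF T] by (simp add: bounded_clinear_def)
  have onorm_le: "onorm (T ^^ n) \<le> M" for n
    unfolding M_def by (rule cSUP_upper[OF _ bdd]) simp
  have M: "0 \<le> M" by (rule order_trans[OF onorm_pos_le[OF Tn] onorm_le])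
  have M_bound: "norm ((T ^^ n) x) \<le> M * norm x" for n x
    by (rule order_trans[OF onorm[OF Tn] mult_right_mono[OF onorm_le]]) simp
  obtain X where X: "bounded_clinear X" "{x. X x = 0} = {0}" "X \<circ> T = U \<circ> X"
    using \<open>T \<sim>\<^sub>o U\<close> unfolding quasisimilar_def quasiaffine_transform_def
    by (elim conjE exE) (rule that)
  obtain Y where Y: "bounded_clinear Y" "{x. Y x = 0} = {0}" "closure (range Y) = UNIV" "Y \<circ> U = T \<circ> Y"
    using \<open>T \<sim>\<^sub>o U\<close> unfolding quasisimilar_def quasiaffine_transform_def
    by (elim conjE exE) (rule that)
  have XT: "X (T x) = U (X x)" for x using fun_cong[OF X(3), of x] by simp
  have YU: "Y (U k) = T (Y k)" for k using fun_cong[OF Y(4), of k] by simp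
  have X0: "x = 0" if "X x = 0" for x using X(2) that by blast
  have Y0: "k = 0" if "Y k = 0" for k using Y(2) that by blast
  obtain J where J: "bounded_clinear J" "bij J" "bounded_clinear (inv J)" "\<And>x. J (T x) = U (J x)"
    "\<And>x. norm x \<le> K * M * norm (J x)" "\<And>x. norm (J x) \<le> M * norm x"
    by (rule similar_to_unitary_if_recurrent[OF K T M M_bound X(1) X0 XT Y(1) Y0 Y(3) YU U surj_U U_inner recurrent], assumption+)
      (rule that)
  have JJ: "J (inv J y) = y" "inv J (J x) = x" for x y
    using J(2) by (simp_all add: bij_is_surj surj_f_inv_f bij_is_inj)
  have "T \<approx>\<^sub>o U"
    unfolding op_similar_def invertible_op_def using J(1-4) by (intro exI[of _ J]) (auto simp: fun_eq_iff)
  moreover have invertible: "invertible_op T"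
  proof -
    define S where "S y = inv J (V (J y))" for y
    have T_eq: "T x = inv J (U (J x))" for x by (metis J(4) JJ(2))
    have TS: "T (S y) = y" and ST: "S (T y) = y" for y
      by (simp_all add: S_def J(4) V JJ) (simp add: T_eq V JJ)
    have "bij T" by (rule o_bij[of S]) (auto simp: fun_eq_iff TS ST)
    moreover have "inv T = S" using TS ST by (intro inv_equality) auto
    moreover have "bounded_clinear S"
      unfolding S_def by (intro bounded_clinear_compose[OF J(3)] bounded_clinear_compose[OF V(1)] J(1))
    ultimately show ?thesis using T by (simp add: invertible_op_def)
  qed
  moreover have "(SUP n\<in>{..0::int}. ereal (onorm (op_powi T n))) \<le>
      ereal (K ^ 3) * (SUP n::nat. ereal (onorm (T ^^ n))) ^ 8"
  proof -
    have U_norm: "norm ((U ^^ n) k) = norm k" for n k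
      by (induction n) (simp_all add: norm_eq_sqrt_inner U_inner)
    \<comment> \<open>With \<open>x\<close> the image of \<open>y\<close> under the inverse power, \<open>U\<close> being isometric gives \<open>norm (J x) = norm (J y)\<close>.\<close>
    have "onorm (op_powi T n) \<le> K * M\<^sup>2" if "n \<le> 0" for n
    proof (rule onorm_bound)
      fix y
      define m where "m = nat (- n)"
      define x where "x = (inv T ^^ m) y"
      have "op_powi T n = inv T ^^ m" using that by (auto simp: op_powi_def m_def)
      moreover have "(T ^^ m) x = y"
      proof -
        have surj: "surj T" using invertible by (simp add: invertible_op_def bij_is_surj)
        have "(T ^^ m) ((inv T ^^ m) z) = z" for z
          by (induction m arbitrary: z) (simp_all add: funpow_swap1[of "inv T"] surj_f_inv_f[OF surj])
        then show ?thesis by (simp add: x_def)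
      qed
      moreover have "norm x \<le> K * M * norm (J ((T ^^ m) x))"
        using J(5)[of x] by (simp add: intertwining_funpow[of J T U, OF J(4)] U_norm)
      moreover have "K * M * norm (J y) \<le> K * M * (M * norm y)"
        by (intro mult_left_mono J(6)) (use K M in simp)
      ultimately show "norm (op_powi T n y) \<le> K * M\<^sup>2 * norm y"
        by (simp add: x_def power2_eq_square mult.assoc)
    qed (use K in simp)
    then have "(SUP n\<in>{..0::int}. ereal (onorm (op_powi T n))) \<le> ereal (K * M\<^sup>2)"
      by (intro SUP_least) simp
    also have "K * M\<^sup>2 \<le> K ^ 3 * M ^ 8"
    proof (cases "\<exists>x::'h. x \<noteq> 0")
      case True
      then obtain x :: 'h where x: "x \<noteq> 0" by blast
      have "1 \<le> M" using M_bound[of 0 x] x by simp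
      define k where "k = J x"
      have "k \<noteq> 0" using J(5)[of x] x by (auto simp: k_def)
      \<comment> \<open>The Cauchy-Schwarz bound \<open>(norm k)\<^sup>2\<close> for the orbit of one nonzero vector forces \<open>K \<ge> 1\<close>.\<close>
      have "(norm k)\<^sup>2 \<le> K * (norm k)\<^sup>2"
        by (rule recurrent, rule always_eventually)
          (metis U_norm cmod_cinner_le power2_eq_square)
      then have "1 \<le> K" using \<open>k \<noteq> 0\<close> by simp
      then show ?thesis
        using \<open>1 \<le> M\<close> by (intro mult_mono power_increasing) (auto simp: self_le_power)
    next
      case False
      then have "norm x = 0" for x :: 'h by simp
      then have "onorm (T ^^ n) \<le> 0" for n by (intro onorm_bound) auto
      then have "M \<le> 0" unfolding M_def by (intro cSUP_least) auto
      then show ?thesis using M by simp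
    qed
    also have "ereal (K ^ 3 * M ^ 8) = ereal (K ^ 3) * (SUP n::nat. ereal (onorm (T ^^ n))) ^ 8"
    proof -
      have "(SUP n::nat. ereal (onorm (T ^^ n))) \<le> ereal M"
        using onorm_le by (intro SUP_least) simp
      moreover have "ereal 0 \<le> (SUP n::nat. ereal (onorm (T ^^ n)))"
        by (rule SUP_upper2[of 0]) (simp_all add: onorm_pos_le[OF Tn[of 0], simplified])
      ultimately have "\<bar>SUP n::nat. ereal (onorm (T ^^ n))\<bar> \<noteq> \<infinity>" by auto
      then have "ereal M = (SUP n::nat. ereal (onorm (T ^^ n)))" unfolding M_def by (rule ereal_SUP)
      then show ?thesis by (metis ereal_power times_ereal.simps(1))
    qed
    finally show ?thesis by simp
  qed
  ultimately show ?thesis by blast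
qed

end
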